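(* Let $\mathsf{PDL}$ be the variety of pseudocomplemented distributive lattices and $\boldsymbol{F}_{\mathsf{PDL}}(\aleph_0)$ its free algebra on countably infinitely many free generators. The class of models of the universal theory $\mathsf{Th}_\forall(\boldsymbol{F}_{\mathsf{PDL}}(\aleph_0))$ is $$\{\boldsymbol{A}\in\mathsf{PDL}:\ \boldsymbol{B}_*\text{ has a free skeleton for every finite subalgebra }\boldsymbol{B}\text{ of }\boldsymbol{A}\}.$$
   Context: A pseudocomplemented distributive lattice is an algebra $\langle A;\wedge,\vee,\neg,0,1\rangle$ with $\langle A;\wedge,\vee,0,1\rangle$ a bounded distributive lattice and $a\leq\neg b\iff a\wedge b=0$ for all $a,b$. $\mathsf{Th}_\forall(\boldsymbol{A})$ is the set of universal sentences ($\forall\vec{x}\,P$, $P$ quantifier-free) valid in $\boldsymbol{A}$. For a finite $\boldsymbol{B}\in\mathsf{PDL}$, $\boldsymbol{B}_*$ is the poset of prime filters of its bounded lattice reduct ordered by inclusion (prime filters are proper and nonempty). For a poset $X$ and $x\in X$, ${\uparrow}x=\{y\in X:x\leq y\}$, and for $Y\subseteq X$, $\max Y$ is the set of maximal elements of the subposet $Y$. A poset $X$ with minimum $\bot$ has a free skeleton when there are elements $s_{x,Y}\in X$, for $x\in X$ and nonempty $Y\subseteq\max{\uparrow}x$, such that: (i) for all $x\in X$ and nonempty $Y\subseteq\max{\uparrow}x$, $s_{x,Y}\in{\uparrow}x$ and $Y=\max{\uparrow}s_{x,Y}$; (ii) for all $x\in X$ and nonempty $Y,Z\subseteq\max{\uparrow}x$,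 $Y\subseteq Z$ implies $s_{x,Z}\leq s_{x,Y}$; (iii) for all $x\in X$ and nonempty $Y\subseteq\max X$, $\max{\uparrow}x\subseteq Y$ implies $s_{\bot,Y}\leq x$. (Having a free skeleton includes having a minimum.) *)

theory Defs
  imports Main
begin

section \<open>Pseudocomplemented distributive lattices\<close>

record 'a alg =
  carrier :: "'a set"
  meet :: "'a \<Rightarrow> 'a \<Rightarrow> 'a" (infixl "\<sqinter>\<index>" 70)
  join :: "'a \<Rightarrow> 'a \<Rightarrow> 'a" (infixl "\<squnion>\<index>" 65)
  neg :: "'a \<Rightarrow> 'a" ("\<sim>\<index> _" [81] 80)
  zero :: 'a ("\<zero>\<index>")
  one :: 'a ("\<one>\<index>")

definition le :: "'a alg \<Rightarrow> 'a \<Rightarrow> 'a \<Rightarrow> bool" (infix "\<sqsubseteq>\<index>" 50)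
  where "le A a b \<longleftrightarrow> meet A a b = a"

text \<open>An arbitrary algebra of the signature; its universe is nonempty because of the constants.\<close>

locale algebra =
  fixes A :: "'a alg" (structure)
  assumes meet_closed: "a \<in> carrier A \<Longrightarrow> b \<in> carrier A \<Longrightarrow> a \<sqinter> b \<in> carrier A"
    and join_closed: "a \<in> carrier A \<Longrightarrow> b \<in> carrier A \<Longrightarrow> a \<squnion> b \<in> carrier A"
    and neg_closed: "a \<in> carrier A \<Longrightarrow> \<sim> a \<in> carrier A"
    and zero_closed: "\<zero> \<in> carrier A"
    and one_closed: "\<one> \<in> carrier A"

locale pdl = algebra +
  assumes meet_assoc:
      "a \<in> carrier A \<Longrightarrow> b \<in> carrier A \<Longrightarrow> c \<in> carrier A \<Longrightarrow> (a \<sqinter> b) \<sqinter> c = a \<sqinter> (b \<sqinter> c)"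
    and join_assoc:
      "a \<in> carrier A \<Longrightarrow> b \<in> carrier A \<Longrightarrow> c \<in> carrier A \<Longrightarrow> (a \<squnion> b) \<squnion> c = a \<squnion> (b \<squnion> c)"
    and meet_comm: "a \<in> carrier A \<Longrightarrow> b \<in> carrier A \<Longrightarrow> a \<sqinter> b = b \<sqinter> a"
    and join_comm: "a \<in> carrier A \<Longrightarrow> b \<in> carrier A \<Longrightarrow> a \<squnion> b = b \<squnion> a"
    and meet_absorb: "a \<in> carrier A \<Longrightarrow> b \<in> carrier A \<Longrightarrow> a \<sqinter> (a \<squnion> b) = a"
    and join_absorb: "a \<in> carrier A \<Longrightarrow> b \<in> carrier A \<Longrightarrow> a \<squnion> (a \<sqinter> b) = a"
    and meet_distrib:
      "a \<in> carrier A \<Longrightarrow> b \<in> carrier A \<Longrightarrow> c \<in> carrier A \<Longrightarrow>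
        a \<sqinter> (b \<squnion> c) = (a \<sqinter> b) \<squnion> (a \<sqinter> c)"
    and zero_least: "a \<in> carrier A \<Longrightarrow> \<zero> \<sqsubseteq> a"
    and one_greatest: "a \<in> carrier A \<Longrightarrow> a \<sqsubseteq> \<one>"
    and pseudocomplement:
      "a \<in> carrier A \<Longrightarrow> b \<in> carrier A \<Longrightarrow> a \<sqsubseteq> \<sim> b \<longleftrightarrow> a \<sqinter> b = \<zero>"

definition subalgebras :: "'a alg \<Rightarrow> 'a alg set"
  where "subalgebras A = {A\<lparr>carrier := S\<rparr> |S. S \<subseteq> carrier A \<and> algebra (A\<lparr>carrier := S\<rparr>)}"

definition is_hom :: "'a alg \<Rightarrow> 'b alg \<Rightarrow> ('a \<Rightarrow> 'b) \<Rightarrow> bool"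
  where "is_hom A B h \<longleftrightarrow>
    h ` carrier A \<subseteq> carrier B \<and>
    (\<forall>a\<in>carrier A. \<forall>b\<in>carrier A. h (meet A a b) = meet B (h a) (h b)) \<and>
    (\<forall>a\<in>carrier A. \<forall>b\<in>carrier A. h (join A a b) = join B (h a) (h b)) \<and>
    (\<forall>a\<in>carrier A. h (neg A a) = neg B (h a)) \<and>
    h (zero A) = zero B \<and> h (one A) = one B"

section \<open>Terms, formulas and universal theories\<close>

datatype 'v trm =
    Var 'v
  | Meet "'v trm" "'v trm"
  | Join "'v trm" "'v trm"
  | Neg "'v trm"
  | Zero
  | One

primrec eval :: "'a alg \<Rightarrow> ('v \<Rightarrow> 'a) \<Rightarrow> 'v trm \<Rightarrow> 'a" where
  "eval A v (Var x) = v x"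
| "eval A v (Meet s t) = meet A (eval A v s) (eval A v t)"
| "eval A v (Join s t) = join A (eval A v s) (eval A v t)"
| "eval A v (Neg t) = neg A (eval A v t)"
| "eval A v Zero = zero A"
| "eval A v One = one A"

datatype form =
    Equ "nat trm" "nat trm"
  | FNot form
  | FAnd form form
  | FOr form form
  | FImp form form
  | FAll nat form

primrec sat :: "'a alg \<Rightarrow> (nat \<Rightarrow> 'a) \<Rightarrow> form \<Rightarrow> bool" where
  "sat A v (Equ s t) \<longleftrightarrow> eval A v s = eval A v t"
| "sat A v (FNot P) \<longleftrightarrow> \<not> sat A v P"
| "sat A v (FAnd P Q) \<longleftrightarrow> sat A v P \<and> sat A v Q"
| "sat A v (FOr P Q) \<longleftrightarrow> sat A v P \<or> sat A v Q"
| "sat A v (FImp P Q) \<longleftrightarrow> (sat A v P \<longrightarrow> sat A v Q)"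
| "sat A v (FAll x P) \<longleftrightarrow> (\<forall>a\<in>carrier A. sat A (v(x := a)) P)"

primrec quantifier_free :: "form \<Rightarrow> bool" where
  "quantifier_free (Equ s t) \<longleftrightarrow> True"
| "quantifier_free (FNot P) \<longleftrightarrow> quantifier_free P"
| "quantifier_free (FAnd P Q) \<longleftrightarrow> quantifier_free P \<and> quantifier_free Q"
| "quantifier_free (FOr P Q) \<longleftrightarrow> quantifier_free P \<and> quantifier_free Q"
| "quantifier_free (FImp P Q) \<longleftrightarrow> quantifier_free P \<and> quantifier_free Q"
| "quantifier_free (FAll x P) \<longleftrightarrow> False"

primrec free_vars :: "form \<Rightarrow> nat set" where
  "free_vars (Equ s t) = set_trm s \<union> set_trm t"
| "free_vars (FNot P) = free_vars P"
| "free_vars (FAnd P Q) = free_vars P \<union> free_vars Q"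
| "free_vars (FOr P Q) = free_vars P \<union> free_vars Q"
| "free_vars (FImp P Q) = free_vars P \<union> free_vars Q"
| "free_vars (FAll x P) = free_vars P - {x}"

definition universal_sentence :: "form \<Rightarrow> bool"
  where "universal_sentence \<phi> \<longleftrightarrow>
    free_vars \<phi> = {} \<and> (\<exists>xs P. quantifier_free P \<and> \<phi> = foldr FAll xs P)"

definition valid :: "'a alg \<Rightarrow> form \<Rightarrow> bool"
  where "valid A \<phi> \<longleftrightarrow> (\<forall>v. range v \<subseteq> carrier A \<longrightarrow> sat A v \<phi>)"

definition universal_theory :: "'a alg \<Rightarrow> form set"
  where "universal_theory A = {\<phi>. universal_sentence \<phi> \<and> valid A \<phi>}"

definition models :: "form set \<Rightarrow> 'a alg set"
  where "models \<Sigma> = {A. algebra A \<and> (\<forall>\<phi>\<in>\<Sigma>. valid A \<phi>)}"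

section \<open>Free pseudocomplemented distributive lattices\<close>

text \<open>\<open>\<approx>\<close> is the least congruence of the term algebra whose quotient is a pseudocomplemented
  distributive lattice; \<open>pc1\<close> and \<open>pc2\<close> are the two directions of
  \<open>a \<le> \<not> b \<longleftrightarrow> a \<and> b = 0\<close>.\<close>

inductive pdl_eq :: "'g trm \<Rightarrow> 'g trm \<Rightarrow> bool" (infix "\<approx>" 50) where
  refl: "s \<approx> s"
| sym: "s \<approx> t \<Longrightarrow> t \<approx> s"
| trans: "s \<approx> t \<Longrightarrow> t \<approx> u \<Longrightarrow> s \<approx> u"
| cong_meet: "s \<approx> s' \<Longrightarrow> t \<approx> t' \<Longrightarrow> Meet s t \<approx> Meet s' t'"
| cong_join: "s \<approx> s' \<Longrightarrow> t \<approx> t' \<Longrightarrow> Join s t \<approx> Join s' t'"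
| cong_neg: "s \<approx> s' \<Longrightarrow> Neg s \<approx> Neg s'"
| meet_assoc: "Meet (Meet a b) c \<approx> Meet a (Meet b c)"
| join_assoc: "Join (Join a b) c \<approx> Join a (Join b c)"
| meet_comm: "Meet a b \<approx> Meet b a"
| join_comm: "Join a b \<approx> Join b a"
| meet_absorb: "Meet a (Join a b) \<approx> a"
| join_absorb: "Join a (Meet a b) \<approx> a"
| meet_distrib: "Meet a (Join b c) \<approx> Join (Meet a b) (Meet a c)"
| zero_least: "Meet Zero a \<approx> Zero"
| one_greatest: "Meet a One \<approx> a"
| pc1: "Meet a (Neg b) \<approx> a \<Longrightarrow> Meet a b \<approx> Zero"
| pc2: "Meet a b \<approx> Zero \<Longrightarrow> Meet a (Neg b) \<approx> a"

quotient_type 'g free = "'g trm" / "pdl_eq"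
  by (intro equivpI reflpI sympI transpI) (blast intro: pdl_eq.intros)+

lift_definition gen :: "'g \<Rightarrow> 'g free" is Var .
lift_definition free_meet :: "'g free \<Rightarrow> 'g free \<Rightarrow> 'g free" is Meet by (rule pdl_eq.cong_meet)
lift_definition free_join :: "'g free \<Rightarrow> 'g free \<Rightarrow> 'g free" is Join by (rule pdl_eq.cong_join)
lift_definition free_neg :: "'g free \<Rightarrow> 'g free" is Neg by (rule pdl_eq.cong_neg)
lift_definition free_zero :: "'g free" is Zero .
lift_definition free_one :: "'g free" is One .

text \<open>The free algebra over the set of all elements of the type \<open>'g\<close>.\<close>

definition free_pdl :: "'g free alg"
  where "free_pdl = \<lparr>carrier = UNIV, meet = free_meet, join = free_join, neg = free_neg,
    zero = free_zero, one = free_one\<rparr>"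

lemma pdl_free_pdl: "pdl (free_pdl :: 'g free alg)"
  unfolding free_pdl_def
  by unfold_locales
    (simp_all add: le_def, (transfer, blast intro: pdl_eq.intros)+)

lemma (in algebra) eval_closed: "range v \<subseteq> carrier A \<Longrightarrow> eval A v t \<in> carrier A"
  by (induction t) (auto intro: meet_closed join_closed neg_closed zero_closed one_closed)

lemma (in pdl) eval_respects:
  assumes "range v \<subseteq> carrier A" "s \<approx> t"
  shows "eval A v s = eval A v t"
proof -
  note bounds = zero_least one_greatest
  show ?thesis
    using assms(2)
  proof (induction rule: pdl_eq.induct)
    case (zero_least a)
    then show ?case using eval_closed[OF assms(1)] bounds by (simp add: le_def)
  next
    case (one_greatest a)
    then show ?case using eval_closed[OF assms(1)] bounds by (simp add: le_def)
  next
    case (pc1 a b)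
    then show ?case using eval_closed[OF assms(1)] pseudocomplement by (simp add: le_def)
  next
    case (pc2 a b)
    then show ?case using eval_closed[OF assms(1)] pseudocomplement by (simp add: le_def)
  qed (use eval_closed[OF assms(1)] in \<open>simp_all add: meet_assoc join_assoc meet_absorb join_absorb
    meet_distrib, (blast intro: meet_comm join_comm)+\<close>)
qed

theorem free_pdl_universal_property:
  fixes A :: "'a alg" and f :: "'g \<Rightarrow> 'a"
  assumes "pdl A" "range f \<subseteq> carrier A"
  shows "\<exists>!h. is_hom free_pdl A h \<and> (\<forall>x. h (gen x) = f x)"
proof -
  interpret pdl A by fact
  define h where "h = (\<lambda>q. eval A f (rep_free q))"
  have h: "h (abs_free t) = eval A f t" for t
    unfolding h_def
    by (rule eval_respects[OF assms(2)])
      (meson Quotient_free Quotient_rep_abs equivp_reflp free_equivp)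
  have hom: "is_hom free_pdl A h"
    unfolding is_hom_def free_pdl_def
  proof (simp, intro conjI allI)
    show "range h \<subseteq> carrier A" unfolding h_def using eval_closed[OF assms(2)] by auto
    fix a b :: "'g free"
    obtain s t where "a = abs_free s" "b = abs_free t"
      by (metis Quotient_abs_rep Quotient_free)
    then show "h (free_meet a b) = meet A (h a) (h b)" "h (free_join a b) = join A (h a) (h b)"
      "h (free_neg a) = neg A (h a)"
      by (simp_all add: h free_meet.abs_eq free_join.abs_eq free_neg.abs_eq)
  qed (simp_all add: h free_zero.abs_eq free_one.abs_eq)
  show ?thesis
  proof (rule ex1I[of _ h])
    show "is_hom free_pdl A h \<and> (\<forall>x. h (gen x) = f x)"
      using hom by (simp add: gen.abs_eq h)
  next
    fix g assume g: "is_hom free_pdl A g \<and> (\<forall>x. g (gen x) = f x)"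
    have "g (abs_free t) = eval A f t" for t
      using g by (induction t)
        (auto simp: is_hom_def free_pdl_def gen.abs_eq
          simp flip: free_meet.abs_eq free_join.abs_eq free_neg.abs_eq free_zero.abs_eq free_one.abs_eq)
    then have "g q = h q" for q using h by (metis Quotient_abs_rep Quotient_free)
    then show "g = h" by blast
  qed
qed

section \<open>Prime filters and free skeletons\<close>

text \<open>The poset \<open>B\<^sub>*\<close>; the order is inclusion, i.e. \<open>(\<le>)\<close> on the type of sets.\<close>

definition prime_filters :: "'a alg \<Rightarrow> 'a set set"
  where "prime_filters B = {F. F \<subseteq> carrier B \<and> F \<noteq> {} \<and> F \<noteq> carrier B \<and>
    (\<forall>a\<in>F. \<forall>b\<in>carrier B. le B a b \<longrightarrow> b \<in> F) \<and>
    (\<forall>a\<in>F. \<forall>b\<in>F. meet B a b \<in> F) \<and>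
    (\<forall>a\<in>carrier B. \<forall>b\<in>carrier B. join B a b \<in> F \<longrightarrow> a \<in> F \<or> b \<in> F)}"

text \<open>A poset is a subset of a partially ordered type with the induced order.\<close>

definition upset :: "'p::order set \<Rightarrow> 'p \<Rightarrow> 'p set"
  where "upset X x = {y \<in> X. x \<le> y}"

definition maximals :: "'p::order set \<Rightarrow> 'p set"
  where "maximals Y = {m \<in> Y. \<forall>y\<in>Y. m \<le> y \<longrightarrow> y = m}"

definition has_free_skeleton :: "'p::order set \<Rightarrow> bool"
  where "has_free_skeleton X \<longleftrightarrow>
    (\<exists>bt\<in>X. (\<forall>x\<in>X. bt \<le> x) \<and>
      (\<exists>s :: 'p \<Rightarrow> 'p set \<Rightarrow> 'p.
        (\<forall>x\<in>X. \<forall>Y. Y \<noteq> {} \<and> Y \<subseteq> maximals (upset X x) \<longrightarrow>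
          s x Y \<in> upset X x \<and> Y = maximals (upset X (s x Y))) \<and>
        (\<forall>x\<in>X. \<forall>Y Z. Y \<noteq> {} \<and> Y \<subseteq> maximals (upset X x) \<and>
          Z \<noteq> {} \<and> Z \<subseteq> maximals (upset X x) \<longrightarrow> Y \<subseteq> Z \<longrightarrow> s x Z \<le> s x Y) \<and>
        (\<forall>x\<in>X. \<forall>Y. Y \<noteq> {} \<and> Y \<subseteq> maximals X \<longrightarrow>
          maximals (upset X x) \<subseteq> Y \<longrightarrow> s bt Y \<le> x)))"

end

theory Submission
  imports Defs
begin

text \<open>Both inclusions come down to a fact about finite pseudocomplemented distributive lattices: such
  an algebra \<open>B\<close> embeds into the free algebra on countably many generators iff \<open>B\<^sub>*\<close> has a free skeleton
  (\<open>embedding_imp_free_skeleton\<close> and \<open>free_skeleton_imp_embedding\<close>).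

  Indeed, a finite subalgebra of a model of the universal theory of any algebra embeds into that
  algebra, since otherwise the negation of its diagram would be in the theory
  (\<open>finite_subalgebra_embeds\<close>). Conversely, pseudocomplemented distributive lattices are locally
  finite (\<open>generated_finite\<close>), so a quantifier-free formula that fails in \<open>A\<close> fails in a finite
  subalgebra, and then also in the free algebra if this subalgebra embeds there.

  The free algebra is handled through a Kripke semantics of terms (\<open>forces\<close>). Its points are the
  pairs \<open>(Y, c)\<close>, where \<open>Y\<close> is a nonempty set of valuations \<open>d\<close> of the variables in \<open>{0, 1}\<close>, given as
  sets of variables, and \<open>c\<close> is a set of variables contained in each of them. Two terms are equal in the
  free algebra iff the same points force them; completeness (\<open>forces_complete\<close>) holds because the prime
  filters of any algebra of the variety yield such points.

  If \<open>B\<close> embeds into the free algebra, then the points map onto \<open>B\<^sub>*\<close> by a map that is monotone and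
  compatible with maximal elements, and the evident free skeleton of the points,
  \<open>s ((Y, c), Z) = (Z, c)\<close>, is transported along it. If \<open>B\<^sub>*\<close> has a free skeleton, then the
  skeleton is used to define such a map onto \<open>B\<^sub>*\<close> from the nonempty subsets of a finite set
  (\<open>free_skeleton_cover\<close>); the points of the free algebra map onto these subsets because finitely
  many generators can distinguish arbitrarily many colours. The dual of the composite embeds \<open>B\<close> into the
  free algebra.\<close>

section \<open>Maximal elements of posets\<close>

lemma maximals_upsetD:
  fixes x :: "'p::order"
  assumes "m \<in> maximals (upset X x)"
  shows "m \<in> X" "x \<le> m" "maximals (upset X m) = {m}" "\<And>y. y \<in> X \<Longrightarrow> m \<le> y \<Longrightarrow> y = m"
proof -
  show m: "m \<in> X" "x \<le> m" using assms by (auto simp: maximals_def upset_def)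
  show max: "y = m" if "y \<in> X" "m \<le> y" for y
    using assms that order_trans[OF m(2) that(2)] by (auto simp: maximals_def upset_def)
  show "maximals (upset X m) = {m}"
    using m(1) max by (auto simp: maximals_def upset_def)
qed

lemma maximals_upset_mono:
  fixes x :: "'p::order"
  assumes "x \<le> y"
  shows "maximals (upset X y) \<subseteq> maximals (upset X x)"
  using assms by (auto simp: maximals_def upset_def)

section \<open>Prime filters of a pseudocomplemented distributive lattice\<close>

context pdl
begin

lemma meet_idem: "a \<in> carrier A \<Longrightarrow> a \<sqinter> a = a"
  by (metis meet_absorb join_absorb meet_closed)

lemma le_refl: "a \<in> carrier A \<Longrightarrow> a \<sqsubseteq> a"
  by (simp add: le_def meet_idem)

lemma le_trans:
  assumes "a \<in> carrier A" "b \<in> carrier A" "c \<in> carrier A" "a \<sqsubseteq> b" "b \<sqsubseteq> c"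
  shows "a \<sqsubseteq> c"
  using assms by (metis le_def meet_assoc)

lemma le_antisym: "a \<in> carrier A \<Longrightarrow> b \<in> carrier A \<Longrightarrow> a \<sqsubseteq> b \<Longrightarrow> b \<sqsubseteq> a \<Longrightarrow> a = b"
  by (metis le_def meet_comm)

lemma meet_le1: "a \<in> carrier A \<Longrightarrow> b \<in> carrier A \<Longrightarrow> a \<sqinter> b \<sqsubseteq> a"
  by (metis le_def meet_assoc meet_comm meet_idem meet_closed)

lemma meet_le2: "a \<in> carrier A \<Longrightarrow> b \<in> carrier A \<Longrightarrow> a \<sqinter> b \<sqsubseteq> b"
  by (metis meet_le1 meet_comm)

lemma le_meet:
  assumes "a \<in> carrier A" "b \<in> carrier A" "c \<in> carrier A" "c \<sqsubseteq> a" "c \<sqsubseteq> b"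
  shows "c \<sqsubseteq> a \<sqinter> b"
  using assms by (metis le_def meet_assoc)

lemma le_join1: "a \<in> carrier A \<Longrightarrow> b \<in> carrier A \<Longrightarrow> a \<sqsubseteq> a \<squnion> b"
  by (simp add: le_def meet_absorb)

lemma le_join2: "a \<in> carrier A \<Longrightarrow> b \<in> carrier A \<Longrightarrow> b \<sqsubseteq> a \<squnion> b"
  by (metis le_join1 join_comm)

lemma join_le:
  assumes "a \<in> carrier A" "b \<in> carrier A" "c \<in> carrier A" "a \<sqsubseteq> c" "b \<sqsubseteq> c"
  shows "a \<squnion> b \<sqsubseteq> c"
proof -
  have "c \<sqinter> a = a" "c \<sqinter> b = b" using assms meet_comm unfolding le_def by metis+
  then have "c \<sqinter> (a \<squnion> b) = a \<squnion> b" using meet_distrib assms(1-3) by simp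
  then show ?thesis using assms(1-3) meet_comm join_closed by (simp add: le_def)
qed

lemma meet_neg: "a \<in> carrier A \<Longrightarrow> a \<sqinter> \<sim> a = \<zero>"
  by (metis le_refl pseudocomplement neg_closed meet_comm)

lemma meet_mono:
  assumes "a \<in> carrier A" "b \<in> carrier A" "c \<in> carrier A" "d \<in> carrier A" "a \<sqsubseteq> b" "c \<sqsubseteq> d"
  shows "a \<sqinter> c \<sqsubseteq> b \<sqinter> d"
  using assms
  by (intro le_meet le_trans[of "a \<sqinter> c" a b] le_trans[of "a \<sqinter> c" c d])
    (auto intro: meet_closed meet_le1 meet_le2)

definition filters :: "'a set set"
  where "filters = {F. F \<subseteq> carrier A \<and> F \<noteq> {} \<and>
    (\<forall>a\<in>F. \<forall>b\<in>carrier A. a \<sqsubseteq> b \<longrightarrow> b \<in> F) \<and> (\<forall>a\<in>F. \<forall>b\<in>F. a \<sqinter> b \<in> F)}"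

lemma filterD:
  assumes "F \<in> filters"
  shows "F \<subseteq> carrier A" "\<one> \<in> F"
    and "a \<in> carrier A \<Longrightarrow> b \<in> carrier A \<Longrightarrow> a \<sqinter> b \<in> F \<longleftrightarrow> a \<in> F \<and> b \<in> F"
    and "a \<in> F \<Longrightarrow> b \<in> carrier A \<Longrightarrow> a \<sqsubseteq> b \<Longrightarrow> b \<in> F"
proof -
  show sub: "F \<subseteq> carrier A" and up: "a \<in> F \<Longrightarrow> b \<in> carrier A \<Longrightarrow> a \<sqsubseteq> b \<Longrightarrow> b \<in> F" for a b
    using assms by (auto simp: filters_def)
  obtain q where "q \<in> F" using assms by (auto simp: filters_def)
  then show "\<one> \<in> F" using up sub one_greatest one_closed by blast
  assume "a \<in> carrier A" "b \<in> carrier A"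
  then show "a \<sqinter> b \<in> F \<longleftrightarrow> a \<in> F \<and> b \<in> F"
    using assms up meet_le1 meet_le2 by (auto simp: filters_def)
qed

lemma principal_filter:
  assumes "a \<in> carrier A"
  shows "{y \<in> carrier A. a \<sqsubseteq> y} \<in> filters"
  using assms unfolding filters_def
  by (auto intro: le_refl le_meet meet_closed le_trans[of a])

lemma filter_adjoin:
  assumes F: "F \<in> filters" and a: "a \<in> carrier A"
  defines "G \<equiv> {y \<in> carrier A. \<exists>q\<in>F. q \<sqinter> a \<sqsubseteq> y}"
  shows "G \<in> filters" "F \<subseteq> G" "a \<in> G"
proof -
  note FD = filterD[OF F]
  have FC: "q \<in> carrier A" if "q \<in> F" for q using FD(1) that by blast
  show "a \<in> G" unfolding G_def using FD(2) a by (auto intro: meet_le2 one_closed)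
  show "F \<subseteq> G" unfolding G_def using FC a by (auto intro: meet_le1)
  have "y \<sqinter> z \<in> G" if yzG: "y \<in> G" "z \<in> G" for y z
  proof -
    obtain p q where pq: "p \<in> F" "q \<in> F" "p \<sqinter> a \<sqsubseteq> y" "q \<sqinter> a \<sqsubseteq> z"
      and yz: "y \<in> carrier A" "z \<in> carrier A"
      using yzG unfolding G_def by blast
    let ?r = "(p \<sqinter> q) \<sqinter> a"
    have r: "?r \<sqsubseteq> p \<sqinter> a" "?r \<sqsubseteq> q \<sqinter> a" "?r \<in> carrier A"
      using pq FC a by (auto intro!: meet_mono le_refl meet_le1 meet_le2 meet_closed)
    then have "?r \<sqsubseteq> y \<sqinter> z"
      using pq FC a yz by (meson le_meet le_trans meet_closed)
    moreover have "p \<sqinter> q \<in> F" using FD(3) FC pq by blast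
    ultimately show ?thesis unfolding G_def using yz meet_closed by blast
  qed
  moreover have "z \<in> G" if yzG: "y \<in> G" "z \<in> carrier A" "y \<sqsubseteq> z" for y z
  proof -
    obtain q where q: "q \<in> F" "q \<sqinter> a \<sqsubseteq> y" "y \<in> carrier A"
      using yzG(1) unfolding G_def by blast
    then have "q \<sqinter> a \<sqsubseteq> z" using yzG le_trans FC a meet_closed by meson
    then show ?thesis using q(1) yzG(2) unfolding G_def by blast
  qed
  moreover have "G \<subseteq> carrier A" unfolding G_def by blast
  ultimately show "G \<in> filters"
    using \<open>a \<in> G\<close> unfolding filters_def by blast
qed

lemma prime_filters_eq:
  "prime_filters A = {F \<in> filters. F \<noteq> carrier A \<and>
    (\<forall>a\<in>carrier A. \<forall>b\<in>carrier A. a \<squnion> b \<in> F \<longrightarrow> a \<in> F \<or> b \<in> F)}"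
  unfolding prime_filters_def filters_def by blast

lemma primeD:
  assumes "P \<in> prime_filters A"
  shows "P \<in> filters" "P \<subseteq> carrier A" "\<one> \<in> P" "\<zero> \<notin> P"
    and "a \<in> carrier A \<Longrightarrow> b \<in> carrier A \<Longrightarrow> a \<sqinter> b \<in> P \<longleftrightarrow> a \<in> P \<and> b \<in> P"
    and "a \<in> carrier A \<Longrightarrow> b \<in> carrier A \<Longrightarrow> a \<squnion> b \<in> P \<longleftrightarrow> a \<in> P \<or> b \<in> P"
proof -
  show F: "P \<in> filters" using assms by (simp add: prime_filters_eq)
  note FD = filterD[OF F]
  show "P \<subseteq> carrier A" "\<one> \<in> P" using FD by auto
  show "\<zero> \<notin> P"
  proof
    assume "\<zero> \<in> P"
    then have "carrier A \<subseteq> P" using FD(4) zero_least by blast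
    then have "P = carrier A" using FD(1) by blast
    then show False using assms by (simp add: prime_filters_eq)
  qed
  assume ab: "a \<in> carrier A" "b \<in> carrier A"
  then show "a \<sqinter> b \<in> P \<longleftrightarrow> a \<in> P \<and> b \<in> P" by (rule FD(3))
  show "a \<squnion> b \<in> P \<longleftrightarrow> a \<in> P \<or> b \<in> P"
  proof
    assume "a \<squnion> b \<in> P"
    then show "a \<in> P \<or> b \<in> P" using assms ab unfolding prime_filters_eq by blast
  next
    assume "a \<in> P \<or> b \<in> P"
    then show "a \<squnion> b \<in> P"
      using FD(4)[OF _ join_closed[OF ab] le_join1[OF ab]]
        FD(4)[OF _ join_closed[OF ab] le_join2[OF ab]] by blast
  qed
qed

text \<open>Zorn's lemma gives a filter that is maximal among those that omit \<open>b\<close>; distributivity makes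
  it prime. With \<open>b = \<zero>\<close> the filter is maximal among all proper filters.\<close>

lemma prime_filter_extension:
  assumes G: "G \<in> filters" and b: "b \<in> carrier A" "b \<notin> G"
  shows "\<exists>P\<in>prime_filters A. G \<subseteq> P \<and> b \<notin> P \<and> (\<forall>F\<in>filters. b \<notin> F \<longrightarrow> P \<subseteq> F \<longrightarrow> F = P)"
proof -
  let ?\<A> = "{F \<in> filters. G \<subseteq> F \<and> b \<notin> F}"
  have "\<exists>P\<in>?\<A>. \<forall>F\<in>?\<A>. P \<subseteq> F \<longrightarrow> F = P"
  proof (rule subset_Zorn_nonempty)
    show "?\<A> \<noteq> {}" using assms by blast
    fix C assume C: "C \<noteq> {}" "subset.chain ?\<A> C"
    have dir: "\<exists>H\<in>C. x \<in> H \<and> y \<in> H" if "x \<in> \<Union>C" "y \<in> \<Union>C" for x y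
      using that C(2) unfolding subset_chain_def by (meson UnionE in_mono)
    have "x \<sqinter> y \<in> \<Union>C" if xy: "x \<in> \<Union>C" "y \<in> \<Union>C" for x y
    proof -
      obtain H where "H \<in> C" "x \<in> H" "y \<in> H" using dir[OF xy] by blast
      moreover from this have "H \<in> filters" using C(2) by (auto simp: subset_chain_def)
      ultimately show ?thesis unfolding filters_def by blast
    qed
    moreover have CF: "H \<in> filters" "G \<subseteq> H" "b \<notin> H" if "H \<in> C" for H
      using C(2) that by (auto simp: subset_chain_def)
    moreover obtain H where H: "H \<in> C" using C(1) by blast
    moreover have "\<one> \<in> H" using filterD(2) CF(1) H by blast
    ultimately have "\<Union>C \<in> filters"
      using filterD(1,4) unfolding filters_def by blast
    then show "\<Union>C \<in> ?\<A>" using CF H by blast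
  qed
  then obtain P where P: "P \<in> filters" "G \<subseteq> P" "b \<notin> P"
    and maxA: "\<forall>F\<in>?\<A>. P \<subseteq> F \<longrightarrow> F = P"
    by blast
  have max: "F = P" if "F \<in> filters" "b \<notin> F" "P \<subseteq> F" for F
    using maxA that subset_trans[OF P(2) that(3)] by simp
  note PD = filterD[OF P(1)]
  \<comment> \<open>By maximality, \<open>P\<close> together with any further element generates a filter that contains \<open>b\<close>.\<close>
  have out: "\<exists>q\<in>P. q \<sqinter> x \<sqsubseteq> b" if "x \<in> carrier A" "x \<notin> P" for x
    using filter_adjoin[OF P(1) that(1)] max that(2) b(1) by blast
  have "x \<in> P \<or> y \<in> P" if xy: "x \<in> carrier A" "y \<in> carrier A" "x \<squnion> y \<in> P" for x y
  proof (rule ccontr)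
    assume "\<not> (x \<in> P \<or> y \<in> P)"
    then obtain p q where pq: "p \<in> P" "q \<in> P" "p \<sqinter> x \<sqsubseteq> b" "q \<sqinter> y \<sqsubseteq> b"
      using out xy by blast
    have pqc: "p \<in> carrier A" "q \<in> carrier A" using pq PD(1) by auto
    define r where "r = p \<sqinter> q"
    have r: "r \<in> P" "r \<in> carrier A" using pq pqc PD(3) by (auto simp: r_def meet_closed)
    have "r \<sqinter> x \<sqsubseteq> b"
      unfolding r_def using pq pqc xy b(1)
      by (intro le_trans[of "(p \<sqinter> q) \<sqinter> x" "p \<sqinter> x" b] meet_mono)
        (auto intro: le_refl meet_le1 meet_closed)
    moreover have "r \<sqinter> y \<sqsubseteq> b"
      unfolding r_def using pq pqc xy b(1)
      by (intro le_trans[of "(p \<sqinter> q) \<sqinter> y" "q \<sqinter> y" b] meet_mono)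
        (auto intro: le_refl meet_le2 meet_closed)
    ultimately have "r \<sqinter> (x \<squnion> y) \<sqsubseteq> b"
      using r xy b(1) by (simp add: meet_distrib join_le meet_closed)
    moreover have "r \<sqinter> (x \<squnion> y) \<in> P" using PD(3) r xy join_closed by blast
    ultimately show False using PD(4) b(1) P(3) by blast
  qed
  moreover have "P \<noteq> carrier A" using P(3) b(1) by blast
  ultimately have "P \<in> prime_filters A"
    using P(1) by (simp add: prime_filters_eq)
  then show ?thesis using P(2,3) max by blast
qed

lemma prime_filter_separation:
  assumes "a \<in> carrier A" "b \<in> carrier A" "\<not> a \<sqsubseteq> b"
  obtains P where "P \<in> prime_filters A" "a \<in> P" "b \<notin> P"
proof -
  have "b \<notin> {y \<in> carrier A. a \<sqsubseteq> y}" using assms(3) by simp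
  then obtain P where "P \<in> prime_filters A" "{y \<in> carrier A. a \<sqsubseteq> y} \<subseteq> P" "b \<notin> P"
    using prime_filter_extension[OF principal_filter[OF assms(1)] assms(2)] by auto
  then show thesis using that assms(1) le_refl by blast
qed

lemma prime_filters_inject:
  assumes "a \<in> carrier A" "b \<in> carrier A" "\<And>P. P \<in> prime_filters A \<Longrightarrow> a \<in> P \<longleftrightarrow> b \<in> P"
  shows "a = b"
  using assms by (metis le_antisym prime_filter_separation)

text \<open>If \<open>\<sim> a\<close> is not in \<open>P\<close>, then no \<open>q \<in> P\<close> satisfies \<open>q \<sqinter> a = \<zero>\<close>, so \<open>P\<close> and \<open>a\<close> generate a proper
  filter, and a maximal proper filter above it is a maximal prime filter. Thus negation on \<open>A\<close> is
  determined by the order of the prime filters: this is where the maximal elements of \<open>A\<^sub>*\<close> enter.\<close>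

lemma neg_mem_iff:
  assumes P: "P \<in> prime_filters A" and a: "a \<in> carrier A"
  shows "\<sim> a \<in> P \<longleftrightarrow> (\<forall>Q\<in>maximals (upset (prime_filters A) P). a \<notin> Q)"
proof
  assume n: "\<sim> a \<in> P"
  show "\<forall>Q\<in>maximals (upset (prime_filters A) P). a \<notin> Q"
  proof (intro ballI notI)
    fix Q assume "Q \<in> maximals (upset (prime_filters A) P)" "a \<in> Q"
    then have Q: "Q \<in> prime_filters A" "\<sim> a \<in> Q" "a \<in> Q"
      using n by (auto simp: maximals_def upset_def)
    then show False
      using primeD(4,5)[OF Q(1)] a neg_closed meet_neg by metis
  qed
next
  assume none: "\<forall>Q\<in>maximals (upset (prime_filters A) P). a \<notin> Q"
  note PD = primeD[OF P]
  let ?G = "{y \<in> carrier A. \<exists>q\<in>P. q \<sqinter> a \<sqsubseteq> y}"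
  show "\<sim> a \<in> P"
  proof (rule ccontr)
    assume n: "\<sim> a \<notin> P"
    have "\<zero> \<notin> ?G"
    proof
      assume "\<zero> \<in> ?G"
      then obtain q where q: "q \<in> P" "q \<sqinter> a \<sqsubseteq> \<zero>" by blast
      then have qc: "q \<in> carrier A" using PD(2) by blast
      then have "q \<sqinter> a = \<zero>"
        using q(2) a by (metis le_antisym zero_least zero_closed meet_closed)
      then have "q \<sqsubseteq> \<sim> a" using pseudocomplement qc a by blast
      then show False using n filterD(4)[OF PD(1) q(1)] a neg_closed by blast
    qed
    then obtain Q where Q: "Q \<in> prime_filters A" "?G \<subseteq> Q"
      and max: "\<forall>F\<in>filters. \<zero> \<notin> F \<longrightarrow> Q \<subseteq> F \<longrightarrow> F = Q"
      using prime_filter_extension[OF filter_adjoin(1)[OF PD(1) a] zero_closed] by auto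
    have "a \<in> Q" "P \<subseteq> Q" using Q(2) filter_adjoin(2,3)[OF PD(1) a] by auto
    moreover have "Q \<in> maximals (upset (prime_filters A) P)"
      using Q \<open>P \<subseteq> Q\<close> primeD(1,4) max unfolding maximals_def upset_def by blast
    ultimately show False using none by blast
  qed
qed

lemma maximals_upset_nonempty:
  assumes "P \<in> prime_filters A"
  shows "maximals (upset (prime_filters A) P) \<noteq> {}"
proof
  assume "maximals (upset (prime_filters A) P) = {}"
  then have "\<sim> \<one> \<in> P" using neg_mem_iff[OF assms one_closed] by simp
  then have "\<one> \<sqinter> \<sim> \<one> \<in> P"
    using primeD(3,5)[OF assms] one_closed neg_closed by blast
  then show False using primeD(4)[OF assms] meet_neg[OF one_closed] by simp
qed

end

section \<open>Kripke semantics of terms\<close>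

text \<open>A point is a pair of a nonempty set \<open>Y\<close> of subsets of the variables and a set \<open>c\<close> of variables
  that is contained in all members of \<open>Y\<close>; it lies below the points with smaller \<open>Y\<close> and larger
  \<open>c\<close>. The maximal points above \<open>(Y, c)\<close> are the pairs \<open>({d}, d)\<close> with \<open>d \<in> Y\<close>, at which terms are
  evaluated as in the two-element Boolean algebra. Hence a pseudocomplement holds at \<open>(Y, c)\<close> when
  its argument fails at each of these. Over finitely many variables the points form the dual poset of
  the free algebra (Urquhart).\<close>

primrec forces :: "'g trm \<Rightarrow> 'g set set \<Rightarrow> 'g set \<Rightarrow> bool" where
  "forces (Var x) Y c \<longleftrightarrow> x \<in> c"
| "forces (Meet s t) Y c \<longleftrightarrow> forces s Y c \<and> forces t Y c"
| "forces (Join s t) Y c \<longleftrightarrow> forces s Y c \<or> forces t Y c"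
| "forces (Neg t) Y c \<longleftrightarrow> (\<forall>d\<in>Y. \<not> forces t {d} d)"
| "forces Zero Y c \<longleftrightarrow> False"
| "forces One Y c \<longleftrightarrow> True"

definition point :: "'g set set \<Rightarrow> 'g set \<Rightarrow> bool"
  where "point Y c \<longleftrightarrow> Y \<noteq> {} \<and> (\<forall>d\<in>Y. c \<subseteq> d)"

lemma point_singleton [simp]: "point {d} d"
  by (simp add: point_def)

lemma forces_mono: "forces t Y c \<Longrightarrow> Y' \<subseteq> Y \<Longrightarrow> c \<subseteq> c' \<Longrightarrow> forces t Y' c'"
  by (induction t) auto

lemma forces_at_max: "forces t Y c \<Longrightarrow> point Y c \<Longrightarrow> d \<in> Y \<Longrightarrow> forces t {d} d"
  by (rule forces_mono) (auto simp: point_def)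

lemma forces_restrict:
  "set_trm t \<subseteq> V \<Longrightarrow> forces t ((\<lambda>d. d \<inter> V) ` Y) (c \<inter> V) \<longleftrightarrow> forces t Y c"
proof (induction t arbitrary: Y c)
  case (Neg t)
  have "forces t {d \<inter> V} (d \<inter> V) \<longleftrightarrow> forces t {d} d" for d
    using Neg.IH[of "{d}" d] Neg.prems by simp
  then show ?case by simp
qed auto

theorem forces_sound: "s \<approx> t \<Longrightarrow> point Y c \<Longrightarrow> forces s Y c \<longleftrightarrow> forces t Y c"
proof (induction arbitrary: Y c rule: pdl_eq.induct)
  case (pc1 a b)
  have "\<not> (forces a Y c \<and> forces b Y c)"
    using pc1.IH[OF pc1.prems] pc1.prems forces_at_max[of b Y c] by (force simp: point_def)
  then show ?case by simp
next
  case (pc2 a b)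
  have "forces (Neg b) Y c" if "forces a Y c"
    using pc2.IH[OF point_singleton] that pc2.prems forces_at_max[of a Y c] by auto
  then show ?case by auto
qed auto

context pdl
begin

definition trace :: "('v \<Rightarrow> 'a) \<Rightarrow> 'a set \<Rightarrow> 'v set"
  where "trace v P = {x. v x \<in> P}"

text \<open>A prime filter \<open>P\<close> corresponds to the point whose \<open>c\<close> is the set of variables with value in \<open>P\<close>
  and whose \<open>Y\<close> records the same for each maximal prime filter above \<open>P\<close>. By \<open>neg_mem_iff\<close> this
  suffices to decide which terms take their value in \<open>P\<close>.\<close>

lemma eval_mem_prime_filter:
  assumes v: "range v \<subseteq> carrier A" and P: "P \<in> prime_filters A"
  shows "eval A v t \<in> P \<longleftrightarrow>
    forces t (trace v ` maximals (upset (prime_filters A) P)) (trace v P)"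
  using P
proof (induction t arbitrary: P)
  case (Neg t)
  have "eval A v t \<in> Q \<longleftrightarrow> forces t {trace v Q} (trace v Q)"
    if Q: "Q \<in> maximals (upset (prime_filters A) P)" for Q
  proof -
    show ?thesis using Neg.IH[OF maximals_upsetD(1)[OF Q]] maximals_upsetD(3)[OF Q] by simp
  qed
  then show ?case using neg_mem_iff[OF Neg.prems eval_closed[OF v]] by simp
qed (auto simp: trace_def primeD[OF _] eval_closed[OF v])

theorem forces_complete:
  assumes v: "range v \<subseteq> carrier A"
    and st: "\<And>Y c. point Y c \<Longrightarrow> forces s Y c \<Longrightarrow> forces t Y c"
  shows "eval A v s \<sqsubseteq> eval A v t"
proof (rule ccontr)
  assume "\<not> eval A v s \<sqsubseteq> eval A v t"
  then obtain P where P: "P \<in> prime_filters A" "eval A v s \<in> P" "eval A v t \<notin> P"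
    using prime_filter_separation eval_closed[OF v] by metis
  have "point (trace v ` maximals (upset (prime_filters A) P)) (trace v P)"
    using maximals_upset_nonempty[OF P(1)]
    by (auto simp: point_def trace_def maximals_def upset_def)
  then show False using st P eval_mem_prime_filter[OF v P(1)] by blast
qed

text \<open>By completeness the value of a term over \<open>V\<close> depends only on the set \<open>U t\<close> of those points over
  \<open>V\<close> that force it, and there are finitely many points over \<open>V\<close>. This is the local finiteness of
  the variety.\<close>

lemma generated_finite:
  assumes v: "range v \<subseteq> carrier A" and V: "finite V"
  shows "finite {eval A v t |t. set_trm t \<subseteq> V}"
proof -
  define U where "U t = {(Y, c). Y \<subseteq> Pow V \<and> c \<subseteq> V \<and> point Y c \<and> forces t Y c}" for t
  define T where "T = {t :: 'b trm. set_trm t \<subseteq> V}"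
  have le: "eval A v s \<sqsubseteq> eval A v t" if st: "s \<in> T" "t \<in> T" "U s \<subseteq> U t" for s t
  proof (rule forces_complete[OF v])
    fix Y c assume Y: "point Y c" "forces s Y c"
    then have "((\<lambda>d. d \<inter> V) ` Y, c \<inter> V) \<in> U s"
      using st forces_restrict[of s V Y c] by (auto simp: U_def T_def point_def)
    then have "((\<lambda>d. d \<inter> V) ` Y, c \<inter> V) \<in> U t" using st(3) by blast
    then show "forces t Y c" using st(2) forces_restrict[of t V Y c] by (simp add: U_def T_def)
  qed
  then have eq: "eval A v s = eval A v t" if "s \<in> T" "t \<in> T" "U s = U t" for s t
    using that le_antisym eval_closed[OF v] by (metis order_refl)
  have "finite (U ` T)"
    by (rule finite_subset[of _ "Pow (Pow (Pow V) \<times> Pow V)"]) (auto simp: U_def V)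
  moreover have "eval A v ` T \<subseteq> (\<lambda>u. eval A v (SOME t. t \<in> T \<and> U t = u)) ` (U ` T)"
  proof clarify
    fix t assume t: "t \<in> T"
    let ?s = "SOME s. s \<in> T \<and> U s = U t"
    have "?s \<in> T \<and> U ?s = U t" by (rule someI[of _ t]) (simp add: t)
    then have "eval A v t = eval A v ?s" using eq t by metis
    then show "eval A v t \<in> (\<lambda>u. eval A v (SOME t. t \<in> T \<and> U t = u)) ` (U ` T)"
      using t by blast
  qed
  ultimately have "finite (eval A v ` T)" by (meson finite_imageI finite_subset)
  moreover have "eval A v ` T = {eval A v t |t. set_trm t \<subseteq> V}" by (auto simp: T_def)
  ultimately show ?thesis by simp
qed

end


section \<open>The free algebra in Kripke semantics\<close>

text \<open>By soundness the representative of the class does not matter at a point; away from the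
  points the value is arbitrary.\<close>

definition holds :: "'g free \<Rightarrow> 'g set set \<Rightarrow> 'g set \<Rightarrow> bool"
  where "holds q = forces (rep_free q)"

lemma holds_abs_free: "point Y c \<Longrightarrow> holds (abs_free t) Y c \<longleftrightarrow> forces t Y c"
  unfolding holds_def
  by (rule forces_sound) (meson Quotient_free Quotient_rep_abs equivp_reflp free_equivp)

lemma holds_mono: "holds q Y c \<Longrightarrow> Y' \<subseteq> Y \<Longrightarrow> c \<subseteq> c' \<Longrightarrow> holds q Y' c'"
  unfolding holds_def by (rule forces_mono)

lemma free_cases: obtains t where "q = abs_free t"
  by (metis Quotient_abs_rep Quotient_free)

lemma holds_free_pdl:
  assumes "point Y c"
  shows "holds (meet free_pdl a b) Y c \<longleftrightarrow> holds a Y c \<and> holds b Y c"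
    and "holds (join free_pdl a b) Y c \<longleftrightarrow> holds a Y c \<or> holds b Y c"
    and "holds (neg free_pdl a) Y c \<longleftrightarrow> (\<forall>d\<in>Y. \<not> holds a {d} d)"
    and "\<not> holds (zero free_pdl) Y c"
    and "holds (one free_pdl) Y c"
proof -
  obtain s where s: "a = abs_free s" by (rule free_cases)
  obtain t where t: "b = abs_free t" by (rule free_cases)
  show "holds (meet free_pdl a b) Y c \<longleftrightarrow> holds a Y c \<and> holds b Y c"
    and "holds (join free_pdl a b) Y c \<longleftrightarrow> holds a Y c \<or> holds b Y c"
    and "holds (neg free_pdl a) Y c \<longleftrightarrow> (\<forall>d\<in>Y. \<not> holds a {d} d)"
    and "\<not> holds (zero free_pdl) Y c"
    and "holds (one free_pdl) Y c"
    using assms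
    by (simp_all add: s t free_pdl_def free_meet.abs_eq free_join.abs_eq free_neg.abs_eq
        free_zero.abs_eq free_one.abs_eq holds_abs_free)
qed

lemma eval_free_pdl: "eval free_pdl gen t = abs_free t"
  by (induction t) (simp_all add: free_pdl_def gen.abs_eq free_meet.abs_eq free_join.abs_eq
      free_neg.abs_eq free_zero.abs_eq free_one.abs_eq)

text \<open>Completeness, applied to the free algebra itself with the generators as values, solves its word
  problem. All identities in the free algebra are verified pointwise in this way.\<close>

lemma free_pdl_eqI:
  assumes "\<And>Y c. point Y c \<Longrightarrow> holds p Y c \<longleftrightarrow> holds q Y c"
  shows "p = q"
proof -
  interpret F: pdl free_pdl by (rule pdl_free_pdl)
  obtain s t where st: "p = abs_free s" "q = abs_free t" by (metis free_cases)
  have g: "range (gen :: 'a \<Rightarrow> 'a free) \<subseteq> carrier free_pdl" by (simp add: free_pdl_def)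
  have "eval free_pdl gen s = eval free_pdl gen t"
    using assms st holds_abs_free
    by (intro F.le_antisym F.forces_complete F.eval_closed g) blast+
  then show ?thesis by (simp add: st eval_free_pdl)
qed

section \<open>Finite subalgebras of free algebras have free skeletons\<close>

context pdl
begin

lemma prime_filter_least:
  assumes P: "P \<in> prime_filters A" and S: "finite S" "S \<subseteq> P"
  shows "\<exists>a\<in>P. \<forall>y\<in>S. a \<sqsubseteq> y"
  using S
proof (induction S)
  case empty
  then show ?case using primeD(3)[OF P] by blast
next
  case (insert y S)
  then obtain a where a: "a \<in> P" "\<forall>z\<in>S. a \<sqsubseteq> z" by auto
  have c: "a \<in> carrier A" "y \<in> carrier A" "S \<subseteq> carrier A"
    using a(1) insert.prems primeD(2)[OF P] by auto
  have "a \<sqinter> y \<sqsubseteq> z" if "z \<in> S" for z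
    using that a c by (meson le_trans meet_closed meet_le1 subsetD)
  moreover have "a \<sqinter> y \<in> P" using a c insert.prems primeD(5)[OF P] by simp
  ultimately show ?case using c meet_le2 by blast
qed

lemma prime_filter_complement_greatest:
  assumes P: "P \<in> prime_filters A" and S: "finite S" "S \<subseteq> carrier A - P"
  shows "\<exists>b\<in>carrier A - P. \<forall>y\<in>S. y \<sqsubseteq> b"
  using S
proof (induction S)
  case empty
  then show ?case using primeD(4)[OF P] zero_closed by blast
next
  case (insert y S)
  then obtain b where b: "b \<in> carrier A - P" "\<forall>z\<in>S. z \<sqsubseteq> b" by auto
  have c: "b \<in> carrier A" "y \<in> carrier A" "S \<subseteq> carrier A"
    using b(1) insert.prems by auto
  have "z \<sqsubseteq> b \<squnion> y" if "z \<in> S" for z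
    using that b c by (meson le_trans join_closed le_join1 subsetD)
  moreover have "b \<squnion> y \<in> carrier A - P"
    using b c insert.prems primeD(6)[OF P] join_closed by auto
  ultimately show ?case using c le_join2 by blast
qed

text \<open>A point \<open>(Y, c)\<close> of the free algebra restricts along \<open>h\<close> to a prime filter \<open>f Y c\<close> of \<open>A\<close>.
  The map \<open>f\<close> is monotone and onto, and it takes the maximal points above a point onto the maximal
  prime filters above its image. The points have an obvious free skeleton: shrink \<open>Y\<close> and keep \<open>c\<close>.
  Choosing a preimage \<open>(pY x, pc x)\<close> of every \<open>x\<close> transports it to \<open>A\<close>, provided that the bottom
  element gets the least point \<open>(UNIV, {})\<close> as its preimage.\<close>

theorem embedding_imp_free_skeleton:
  fixes h :: "'a \<Rightarrow> 'g free"
  assumes fin: "finite (carrier A)" and hom: "is_hom A free_pdl h" and inj: "inj_on h (carrier A)"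
  shows "has_free_skeleton (prime_filters A)"
proof -
  define X where "X = prime_filters A"
  define f where "f Y c = {b \<in> carrier A. holds (h b) Y c}" for Y c
  have h: "h (a \<sqinter> b) = meet free_pdl (h a) (h b)" "h (a \<squnion> b) = join free_pdl (h a) (h b)"
    "h (\<sim> a) = neg free_pdl (h a)" "h \<zero> = zero free_pdl" "h \<one> = one free_pdl"
    if "a \<in> carrier A" "b \<in> carrier A" for a b
    using hom that by (auto simp: is_hom_def)
  have fX: "f Y c \<in> X" if p: "point Y c" for Y c
  proof -
    have "\<one> \<in> f Y c" "\<zero> \<notin> f Y c"
      using h[OF one_closed zero_closed] holds_free_pdl[OF p] one_closed by (simp_all add: f_def)
    moreover have "b \<in> f Y c" if "a \<in> f Y c" "b \<in> carrier A" "a \<sqsubseteq> b" for a b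
      using that h(1)[of a b] holds_free_pdl(1)[OF p, of "h a" "h b"] by (simp add: f_def le_def)
    moreover have "a \<sqinter> b \<in> f Y c" if "a \<in> f Y c" "b \<in> f Y c" for a b
      using that h(1) holds_free_pdl(1)[OF p] meet_closed by (simp add: f_def)
    moreover have "a \<in> f Y c \<or> b \<in> f Y c"
      if "a \<squnion> b \<in> f Y c" "a \<in> carrier A" "b \<in> carrier A" for a b
      using that h(2) holds_free_pdl(2)[OF p] by (simp add: f_def)
    moreover have "f Y c \<subseteq> carrier A" by (auto simp: f_def)
    ultimately show ?thesis
      using zero_closed unfolding X_def prime_filters_def by blast
  qed
  have f_mono: "f Y c \<subseteq> f Y' c'" if "Y' \<subseteq> Y" "c \<subseteq> c'" for Y c Y' c'
    using that holds_mono unfolding f_def by blast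
  have f_onto: "\<exists>Y c. point Y c \<and> f Y c = P" if P: "P \<in> X" for P
  proof -
    have PX: "P \<in> prime_filters A" using P by (simp add: X_def)
    note PD = primeD[OF PX]
    \<comment> \<open>In a finite algebra \<open>P\<close> has a least element \<open>a\<close> and its complement a greatest element \<open>b\<close>;
        a point at which \<open>h a\<close> holds and \<open>h b\<close> fails restricts to \<open>P\<close>.\<close>
    obtain a where a: "a \<in> P" "\<forall>y\<in>P. a \<sqsubseteq> y"
      using prime_filter_least[OF PX _ subset_refl] fin PD(2) finite_subset by blast
    obtain b where b: "b \<in> carrier A" "b \<notin> P" "\<forall>y\<in>carrier A - P. y \<sqsubseteq> b"
      using prime_filter_complement_greatest[OF PX _ subset_refl] fin by blast
    have ac: "a \<in> carrier A" using a(1) PD(2) by blast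
    have "a \<sqinter> b \<noteq> a" using filterD(4)[OF PD(1) a(1) b(1)] b(2) by (auto simp: le_def)
    then have "h (a \<sqinter> b) \<noteq> h a" using inj ac b(1) meet_closed by (auto dest: inj_onD)
    then obtain Y c where p: "point Y c" and "holds (h (a \<sqinter> b)) Y c \<noteq> holds (h a) Y c"
      using free_pdl_eqI by blast
    then have Y: "a \<in> f Y c" "b \<notin> f Y c"
      using h(1)[OF ac b(1)] holds_free_pdl(1)[OF p] ac by (auto simp: f_def)
    have filt: "f Y c \<in> filters" using fX[OF p] primeD(1) by (simp add: X_def)
    have "P \<subseteq> f Y c" using a(2) Y(1) PD(2) filterD(4)[OF filt] by blast
    moreover have "f Y c \<subseteq> P" using b Y(2) filterD(1,4)[OF filt] by blast
    ultimately show ?thesis using p by blast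
  qed
  \<comment> \<open>The maximal points are Boolean, so their images are ultrafilters.\<close>
  have ultra: "\<sim> b \<in> f {d} d" if "b \<in> carrier A" "b \<notin> f {d} d" for b d
    using that h(3)[of b b] holds_free_pdl(3)[of "{d}" d] neg_closed by (simp add: f_def)
  have f_max: "P = f {d} d" if P: "P \<in> X" "f {d} d \<subseteq> P" for P d
  proof -
    have PX: "P \<in> prime_filters A" using P by (simp add: X_def)
    have "b \<in> f {d} d" if b: "b \<in> P" for b
    proof (rule ccontr)
      assume "b \<notin> f {d} d"
      moreover have bc: "b \<in> carrier A" using b primeD(2)[OF PX] by blast
      ultimately have "\<sim> b \<in> P" using ultra P(2) by blast
      then show False using primeD(4,5)[OF PX] bc b neg_closed meet_neg by metis
    qed
    then show ?thesis using P(2) by blast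
  qed
  have max_f: "maximals (upset X (f Y c)) = (\<lambda>d. f {d} d) ` Y" if p: "point Y c" for Y c
  proof
    show "(\<lambda>d. f {d} d) ` Y \<subseteq> maximals (upset X (f Y c))"
    proof clarify
      fix d assume "d \<in> Y"
      then have "f Y c \<subseteq> f {d} d" using p by (intro f_mono) (auto simp: point_def)
      then show "f {d} d \<in> maximals (upset X (f Y c))"
        using fX[OF point_singleton] f_max unfolding maximals_def upset_def by blast
    qed
  next
    show "maximals (upset X (f Y c)) \<subseteq> (\<lambda>d. f {d} d) ` Y"
    proof
      fix Q assume Q: "Q \<in> maximals (upset X (f Y c))"
      note QX = maximals_upsetD[OF Q]
      have Qp: "Q \<in> prime_filters A" using QX(1) by (simp add: X_def)
      \<comment> \<open>The least element \<open>a\<close> of \<open>Q\<close> must hold at some \<open>d \<in> Y\<close>, as otherwise \<open>\<sim> a \<in> f Y c \<subseteq> Q\<close>.\<close>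
      obtain a where a: "a \<in> Q" "\<forall>y\<in>Q. a \<sqsubseteq> y"
        using prime_filter_least[OF Qp _ subset_refl] fin primeD(2)[OF Qp] finite_subset by blast
      have ac: "a \<in> carrier A" using a(1) primeD(2)[OF Qp] by blast
      have "\<sim> a \<notin> Q" using primeD(4,5)[OF Qp] ac a(1) neg_closed meet_neg by metis
      then have "\<sim> a \<notin> f Y c" using QX(2) by blast
      then obtain d where d: "d \<in> Y" "a \<in> f {d} d"
        using h(3)[OF ac ac] holds_free_pdl(3)[OF p] ac neg_closed by (auto simp: f_def)
      have "f {d} d \<in> filters" using fX[OF point_singleton] primeD(1) by (simp add: X_def)
      then have "Q \<subseteq> f {d} d" using a(2) d(2) primeD(2)[OF Qp] filterD(4) by blast
      then have "f {d} d = Q" using QX(4) fX[OF point_singleton] by blast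
      then show "Q \<in> (\<lambda>d. f {d} d) ` Y" using d(1) by blast
    qed
  qed
  define bt where "bt = f UNIV {}"
  have "\<exists>Y c. point Y c \<and> f Y c = x \<and> (x = bt \<longrightarrow> Y = UNIV \<and> c = {})" if "x \<in> X" for x
  proof (cases "x = bt")
    case True
    then show ?thesis unfolding bt_def point_def by blast
  next
    case False
    then show ?thesis using f_onto[OF that] by blast
  qed
  then obtain pY pc where p: "\<And>x. x \<in> X \<Longrightarrow> point (pY x) (pc x)"
      "\<And>x. x \<in> X \<Longrightarrow> f (pY x) (pc x) = x"
      and pbt: "\<And>x. x \<in> X \<Longrightarrow> x = bt \<Longrightarrow> pY x = UNIV \<and> pc x = {}"
    by metis
  define s where "s x Z = f {d \<in> pY x. f {d} d \<in> Z} (pc x)" for x Z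
  have btX: "bt \<in> X" unfolding bt_def by (rule fX) (simp add: point_def)
  have bt_le: "bt \<le> x" if "x \<in> X" for x
    using f_mono[of "pY x" UNIV "{}" "pc x"] p(2)[OF that] by (simp add: bt_def)
  have s1: "s x Z \<in> upset X x \<and> Z = maximals (upset X (s x Z))"
    if x: "x \<in> X" and Z: "Z \<noteq> {}" "Z \<subseteq> maximals (upset X x)" for x Z
  proof -
    let ?Y = "{d \<in> pY x. f {d} d \<in> Z}"
    have Z': "Z \<subseteq> (\<lambda>d. f {d} d) ` pY x" using max_f[OF p(1)[OF x]] Z(2) p(2)[OF x] by simp
    then have "(\<lambda>d. f {d} d) ` ?Y = Z" by blast
    moreover from this have pt: "point ?Y (pc x)"
      using Z(1) p(1)[OF x] by (auto simp: point_def)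
    moreover have "x \<subseteq> s x Z"
      using f_mono[of ?Y "pY x" "pc x" "pc x"] p(2)[OF x] by (auto simp: s_def)
    ultimately show ?thesis
      using fX[OF pt] max_f[OF pt] by (simp add: s_def upset_def)
  qed
  moreover have "s x Z \<le> s x Y" if "Y \<subseteq> Z" for x Y Z
    unfolding s_def using that by (intro f_mono) auto
  moreover have "s bt Y \<le> x" if x: "x \<in> X" and Y: "maximals (upset X x) \<subseteq> Y" for x Y
  proof -
    have "(\<lambda>d. f {d} d) ` pY x \<subseteq> Y" using max_f[OF p(1)[OF x]] Y p(2)[OF x] by simp
    then have "s bt Y \<subseteq> f (pY x) (pc x)"
      using pbt[OF btX] unfolding s_def by (intro f_mono) auto
    then show ?thesis using p(2)[OF x] by simp
  qed
  ultimately show ?thesis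
    unfolding has_free_skeleton_def X_def[symmetric]
    using btX bt_le by (intro bexI[of _ bt] conjI exI[of _ s]) simp_all
qed

end

section \<open>Finite algebras with a free skeleton embed into the free algebra\<close>

text \<open>The nonempty subsets of a finite set \<open>M\<close>, ordered by reverse inclusion, form a poset with the
  singletons as maximal elements, and \<open>f\<close> is a map from it onto \<open>X\<close> that is dual to an embedding of
  algebras. The set \<open>M\<close> is a disjoint union of blocks \<open>D x\<close>, each listing the maximal elements above \<open>x\<close>, and
  \<open>g\<close> forgets the block. A set \<open>Y\<close> that meets several blocks goes to \<open>s\<^bsub>\<bottom>,g[Y]\<^esub>\<close>, a proper subset of
  \<open>D x\<close> goes to \<open>s\<^bsub>x,g[Y]\<^esub>\<close>, and \<open>D x\<close> itself goes to \<open>x\<close>, which makes the map onto. Property (iii) of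
  free skeletons is exactly what keeps the first kind of value below those at the subsets of \<open>Y\<close>. Singletons are
  exceptional because they must have maximal images, and \<open>s\<^bsub>x,{m}\<^esub>\<close> need not be \<open>m\<close>. The Boolean tag
  doubles every element, so that no \<open>D x\<close> is a singleton.\<close>

lemma free_skeleton_cover:
  fixes X :: "'p::order set"
  assumes skel: "has_free_skeleton X" and fin: "finite X"
  obtains M :: "('p \<times> 'p \<times> bool) set" and f
  where "finite M" "M \<noteq> {}"
    and "\<And>Y. Y \<noteq> {} \<Longrightarrow> Y \<subseteq> M \<Longrightarrow> f Y \<in> X"
    and "\<And>Y. Y \<noteq> {} \<Longrightarrow> Y \<subseteq> M \<Longrightarrow> maximals (upset X (f Y)) = (\<lambda>q. f {q}) ` Y"
    and "\<And>Y Z. Y \<noteq> {} \<Longrightarrow> Y \<subseteq> Z \<Longrightarrow> Z \<subseteq> M \<Longrightarrow> f Z \<le> f Y"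
    and "\<And>x. x \<in> X \<Longrightarrow> \<exists>Y. Y \<noteq> {} \<and> Y \<subseteq> M \<and> f Y = x"
proof -
  let ?max = "\<lambda>x. maximals (upset X x)"
  obtain bt s where bt: "bt \<in> X" "\<And>x. x \<in> X \<Longrightarrow> bt \<le> x"
    and s1: "\<And>x Y. x \<in> X \<Longrightarrow> Y \<noteq> {} \<Longrightarrow> Y \<subseteq> ?max x \<Longrightarrow> s x Y \<in> upset X x"
    and s2: "\<And>x Y. x \<in> X \<Longrightarrow> Y \<noteq> {} \<Longrightarrow> Y \<subseteq> ?max x \<Longrightarrow> ?max (s x Y) = Y"
    and s3: "\<And>x Y Z. x \<in> X \<Longrightarrow> Y \<noteq> {} \<Longrightarrow> Y \<subseteq> Z \<Longrightarrow> Z \<subseteq> ?max x \<Longrightarrow> s x Z \<le> s x Y"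
    and s4: "\<And>x Y. x \<in> X \<Longrightarrow> Y \<noteq> {} \<Longrightarrow> Y \<subseteq> maximals X \<Longrightarrow> ?max x \<subseteq> Y \<Longrightarrow> s bt Y \<le> x"
    using skel unfolding has_free_skeleton_def
    by (smt (verit, ccfv_threshold) subset_trans subset_empty)
  have up_bt: "upset X bt = X" using bt by (auto simp: upset_def)
  have max_ne: "?max x \<noteq> {}" if "x \<in> X" for x
  proof -
    have "finite (upset X x)" "upset X x \<noteq> {}" using fin that by (auto simp: upset_def)
    then obtain m where "m \<in> upset X x" "\<forall>y\<in>upset X x. m \<le> y \<longrightarrow> m = y"
      using finite_has_maximal by blast
    then show ?thesis unfolding maximals_def by blast
  qed
  define D where "D x = {x} \<times> ?max x \<times> (UNIV :: bool set)" for x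
  define M where "M = (\<Union>x\<in>X. D x)"
  define g :: "'p \<times> 'p \<times> bool \<Rightarrow> 'p" where "g q = fst (snd q)" for q
  define base where "base Y = (if \<exists>x\<in>X. Y \<subseteq> D x then SOME x. x \<in> X \<and> Y \<subseteq> D x else bt)" for Y
  define f where "f Y = (if is_singleton Y then g (the_elem Y)
    else if Y = D (base Y) then base Y else s (base Y) (g ` Y))" for Y
  have gD: "g ` D x = ?max x" for x by (auto simp: D_def g_def image_iff)
  have max_bt: "?max x \<subseteq> ?max bt" if "x \<in> X" for x
    by (rule maximals_upset_mono[OF bt(2)[OF that]])
  have gM: "g ` Y \<subseteq> ?max bt" if "Y \<subseteq> M" for Y
    using that gD max_bt unfolding M_def by blast
  have base_eq: "base Y = x" if "x \<in> X" "Y \<subseteq> D x" "Y \<noteq> {}" for x Y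
  proof -
    have "y = x" if "Y \<subseteq> D y" for y
      using that \<open>Y \<subseteq> D x\<close> \<open>Y \<noteq> {}\<close> by (auto simp: D_def)
    then show ?thesis using that(1,2) unfolding base_def by (smt (verit) someI_ex)
  qed
  have base: "base Y \<in> X" "g ` Y \<subseteq> ?max (base Y)" if Y: "Y \<noteq> {}" "Y \<subseteq> M" for Y
  proof -
    have "base Y \<in> X \<and> g ` Y \<subseteq> ?max (base Y)"
    proof (cases "\<exists>x\<in>X. Y \<subseteq> D x")
      case True
      then obtain x where x: "x \<in> X" "Y \<subseteq> D x" by blast
      then have "base Y = x" using base_eq Y(1) by blast
      then show ?thesis using x image_mono[OF x(2), of g] gD by simp
    next
      case False
      then have "base Y = bt" by (auto simp: base_def)
      then show ?thesis using bt(1) gM[OF Y(2)] by simp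
    qed
    then show "base Y \<in> X" "g ` Y \<subseteq> ?max (base Y)" by auto
  qed
  have f_single: "f {q} = g q" for q by (simp add: f_def)
  have f: "f Y \<in> X \<and> ?max (f Y) = g ` Y" if Y: "Y \<noteq> {}" "Y \<subseteq> M" for Y
  proof -
    consider (single) q where "Y = {q}" | (full) "\<not> is_singleton Y" "Y = D (base Y)"
      | (skel) "\<not> is_singleton Y" "Y \<noteq> D (base Y)"
      by (auto simp: is_singleton_def)
    then show ?thesis
    proof cases
      case single
      then have "g q \<in> ?max bt" using gM Y by blast
      from maximals_upsetD(1,3)[OF this] show ?thesis by (simp add: single f_single)
    next
      case full
      then have "f Y = base Y" by (simp add: f_def)
      moreover have "g ` Y = ?max (base Y)" using full(2) gD by metis
      ultimately show ?thesis using base(1)[OF Y] by simp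
    next
      case skel
      then have "f Y = s (base Y) (g ` Y)" by (simp add: f_def)
      then show ?thesis
        using s1[OF base(1)[OF Y] _ base(2)[OF Y]] s2[OF base(1)[OF Y] _ base(2)[OF Y]] Y(1)
        by (simp add: upset_def)
    qed
  qed
  have f_anti: "f Z \<le> f Y" if YZ: "Y \<noteq> {}" "Y \<subseteq> Z" "Z \<subseteq> M" for Y Z
  proof -
    have YM: "Y \<subseteq> M" and Z: "Z \<noteq> {}" using YZ by auto
    consider (single) q where "Y = {q}" | (eq) "Y = Z"
      | (full) "\<not> is_singleton Y" "Y \<noteq> Z" "Z = D (base Z)"
      | (skel) "\<not> is_singleton Y" "Y \<noteq> Z" "Z \<noteq> D (base Z)"
      by (auto simp: is_singleton_def)
    then show ?thesis
    proof cases
      case single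
      then have "f Y \<in> ?max (f Z)" using f[OF Z YZ(3)] YZ(2) f_single by auto
      then show ?thesis by (rule maximals_upsetD(2))
    next
      case eq
      then show ?thesis by simp
    next
      case full
      have Zs: "\<not> is_singleton Z" using full(1) YZ(1,2) by (auto simp: is_singleton_def)
      have Y: "base Y = base Z" using base_eq[OF base(1)[OF Z YZ(3)] _ YZ(1)] YZ(2) full(3) by simp
      then have "f Y = s (base Z) (g ` Y)" using full by (auto simp: f_def)
      moreover have "f Z = base Z" using full(3) Zs by (simp add: f_def)
      moreover have "base Z \<le> s (base Z) (g ` Y)"
        using s1[OF base(1)[OF YZ(1) YM] _ base(2)[OF YZ(1) YM]] YZ(1) Y by (simp add: upset_def)
      ultimately show ?thesis by simp
    next
      case skel
      have Zs: "\<not> is_singleton Z" using skel(1) YZ(1,2) by (auto simp: is_singleton_def)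
      have fZ: "f Z = s (base Z) (g ` Z)" using skel Zs by (simp add: f_def)
      show ?thesis
      proof (cases "\<exists>x\<in>X. Z \<subseteq> D x")
        case True
        then obtain x where x: "x \<in> X" "Z \<subseteq> D x" by blast
        then have bs: "base Z = x" "base Y = x"
          using base_eq[OF x(1,2) Z] base_eq[OF x(1) subset_trans[OF YZ(2) x(2)] YZ(1)] by auto
        have "Y \<noteq> D x" using skel YZ x bs by blast
        then have "f Y = s x (g ` Y)" using skel(1) bs by (simp add: f_def)
        moreover have "s x (g ` Z) \<le> s x (g ` Y)"
          using s3[OF x(1)] YZ base(2)[OF Z YZ(3)] bs(1) by (simp add: image_mono)
        ultimately show ?thesis using fZ bs by simp
      next
        case False
        then have "base Z = bt" by (auto simp: base_def)
        moreover have "s bt (g ` Z) \<le> f Y"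
          using s4[of "f Y" "g ` Z"] f[OF YZ(1) YM] Z gM[OF YZ(3)] YZ(2) up_bt
          by (simp add: image_mono)
        ultimately show ?thesis using fZ by simp
      qed
    qed
  qed
  have onto: "\<exists>Y. Y \<noteq> {} \<and> Y \<subseteq> M \<and> f Y = x" if x: "x \<in> X" for x
  proof -
    obtain m where m: "m \<in> ?max x" using max_ne[OF x] by blast
    then have D: "(x, m, True) \<in> D x" "(x, m, False) \<in> D x" by (auto simp: D_def)
    then have "\<not> is_singleton (D x)" by (auto simp: is_singleton_def)
    moreover have "base (D x) = x" using base_eq[OF x] D by blast
    ultimately have "f (D x) = x" by (simp add: f_def)
    then show ?thesis using D x unfolding M_def by blast
  qed
  have "finite (?max x)" for x using fin by (auto simp: maximals_def upset_def)
  then have "finite M" using fin by (simp add: M_def D_def)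
  moreover have "M \<noteq> {}" using onto[OF bt(1)] by blast
  ultimately show thesis
    using that[of M f] f f_anti onto f_single by simp
qed

text \<open>Boolean functions of finitely many variables are terms, by Shannon expansion.\<close>

lemma boolean_term:
  assumes "finite V" "\<And>d. \<beta> (d \<inter> V) \<longleftrightarrow> \<beta> d"
  shows "\<exists>t. \<forall>d. forces t {d} d \<longleftrightarrow> \<beta> d"
  using assms
proof (induction V arbitrary: \<beta>)
  case empty
  then have "\<beta> d \<longleftrightarrow> \<beta> {}" for d by (metis inf_bot_right)
  then show ?case by (cases "\<beta> {}") (auto intro: exI[of _ One] exI[of _ Zero])
next
  case (insert x V)
  have "insert x (d \<inter> V) = insert x d \<inter> insert x V" for d by auto
  then have "\<beta> (insert x (d \<inter> V)) \<longleftrightarrow> \<beta> (insert x d)" for d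
    using insert.prems[of "insert x d"] by simp
  then obtain t1 where t1: "\<And>d. forces t1 {d} d \<longleftrightarrow> \<beta> (insert x d)"
    using insert.IH[of "\<lambda>d. \<beta> (insert x d)"] by blast
  have "(d \<inter> V) - {x} = (d - {x}) \<inter> insert x V" for d by auto
  then have "\<beta> ((d \<inter> V) - {x}) \<longleftrightarrow> \<beta> (d - {x})" for d
    using insert.prems[of "d - {x}"] by simp
  then obtain t0 where t0: "\<And>d. forces t0 {d} d \<longleftrightarrow> \<beta> (d - {x})"
    using insert.IH[of "\<lambda>d. \<beta> (d - {x})"] by blast
  have "forces (Join (Meet (Var x) t1) (Meet (Neg (Var x)) t0)) {d} d \<longleftrightarrow> \<beta> d" for d
    by (cases "x \<in> d") (simp_all add: t0 t1 insert_absorb)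
  then show ?case by blast
qed

lemma finite_join_term:
  assumes "finite S"
  shows "\<exists>t. \<forall>Y c. forces t Y c \<longleftrightarrow> (\<exists>D\<in>S. forces (r D) Y c)"
  using assms
proof (induction S)
  case empty
  show ?case by (rule exI[of _ Zero]) simp
next
  case (insert D S)
  then obtain t where "\<And>Y c. forces t Y c \<longleftrightarrow> (\<exists>D\<in>S. forces (r D) Y c)" by blast
  then show ?case by (intro exI[of _ "Join (r D) t"]) simp
qed

text \<open>Any finite number of values can be told apart by finitely many generators: count the
  generators that hold.\<close>

lemma finite_colouring:
  assumes "finite M" "M \<noteq> {}"
  obtains k :: "nat set \<Rightarrow> 'm" and V where "finite V" "range k = M" "\<And>d. k (d \<inter> V) = k d"
proof -
  obtain n where n: "card M = Suc n" using assms by (metis card_eq_0_iff not0_implies_Suc)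
  obtain e where "bij_betw e {0..<card M} M" using ex_bij_betw_nat_finite[OF assms(1)] by blast
  then have e: "e ` {..n} = M"
    by (simp add: bij_betw_def n atLeast0LessThan lessThan_Suc_atMost)
  define k where "k d = e (card (d \<inter> {..<n}))" for d
  have "card (d \<inter> {..<n}) \<le> n" for d by (metis card_lessThan card_mono finite_lessThan inf_le2)
  then have "range k \<subseteq> e ` {..n}" by (auto simp: k_def)
  moreover have "e i = k {..<i}" if "i \<le> n" for i
  proof -
    have "{..<i} \<inter> {..<n} = {..<i}" using that by auto
    then show ?thesis by (simp add: k_def)
  qed
  then have "e ` {..n} \<subseteq> range k" by auto
  ultimately have "range k = M" using e by simp
  then show thesis using that[of "{..<n}" k] by (simp add: k_def Int_assoc)
qed

text \<open>Colour the valuations \<open>d\<close> by elements \<open>k d\<close> of \<open>M\<close>. The points \<open>(Y, c)\<close> of the free algebra then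
  map onto the nonempty subsets \<open>k ` Y\<close> of \<open>M\<close>, hence onto the prime filters of \<open>A\<close> by the map \<open>f\<close> of
  \<open>free_skeleton_cover\<close>. Dually, \<open>b\<close> is sent to a term that holds at \<open>(Y, c)\<close> iff \<open>b \<in> f (k ` Y)\<close>. Such
  a term exists because \<open>f\<close> is antitone: it is the join, over the \<open>D\<close> with \<open>b \<in> f D\<close>, of
  doubly negated Boolean terms that hold at \<open>(Y, c)\<close> iff \<open>k ` Y \<subseteq> D\<close>.\<close>

theorem (in pdl) free_skeleton_imp_embedding:
  assumes fin: "finite (carrier A)" and skel: "has_free_skeleton (prime_filters A)"
  shows "\<exists>h :: 'a \<Rightarrow> nat free. is_hom A free_pdl h \<and> inj_on h (carrier A)"
proof -
  let ?X = "prime_filters A"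
  have "finite ?X" by (rule finite_subset[of _ "Pow (carrier A)"]) (auto simp: prime_filters_def fin)
  with skel obtain M :: "('a set \<times> 'a set \<times> bool) set" and f where M: "finite M" "M \<noteq> {}"
    and fX: "\<And>Y. Y \<noteq> {} \<Longrightarrow> Y \<subseteq> M \<Longrightarrow> f Y \<in> ?X"
    and fmax: "\<And>Y. Y \<noteq> {} \<Longrightarrow> Y \<subseteq> M \<Longrightarrow> maximals (upset ?X (f Y)) = (\<lambda>q. f {q}) ` Y"
    and fanti: "\<And>Y Z. Y \<noteq> {} \<Longrightarrow> Y \<subseteq> Z \<Longrightarrow> Z \<subseteq> M \<Longrightarrow> f Z \<le> f Y"
    and fonto: "\<And>x. x \<in> ?X \<Longrightarrow> \<exists>Y. Y \<noteq> {} \<and> Y \<subseteq> M \<and> f Y = x"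
    by (rule free_skeleton_cover) blast
  obtain k :: "nat set \<Rightarrow> 'a set \<times> 'a set \<times> bool" and V
    where V: "finite V" and k: "range k = M" and kV: "\<And>d. k (d \<inter> V) = k d"
    by (rule finite_colouring[OF M]) blast
  have kM: "k ` Y \<subseteq> M" for Y using k by blast
  have "\<forall>D. \<exists>t. \<forall>d. forces t {d} d \<longleftrightarrow> k d \<in> D"
    using boolean_term[OF V] kV by simp
  then obtain r where r: "\<And>D d. forces (r D) {d} d \<longleftrightarrow> k d \<in> D" by metis
  have "\<exists>t. \<forall>Y c. point Y c \<longrightarrow> (forces t Y c \<longleftrightarrow> b \<in> f (k ` Y))" for b
  proof -
    let ?S = "{D. D \<noteq> {} \<and> D \<subseteq> M \<and> b \<in> f D}"
    have "finite ?S" by (rule finite_subset[of _ "Pow M"]) (auto simp: M(1))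
    then obtain t where t: "\<And>Y c. forces t Y c \<longleftrightarrow> (\<exists>D\<in>?S. forces (Neg (Neg (r D))) Y c)"
      using finite_join_term[of ?S "\<lambda>D. Neg (Neg (r D))"] by blast
    have "forces t Y c \<longleftrightarrow> b \<in> f (k ` Y)" if "point Y c" for Y c
    proof -
      have ne: "k ` Y \<noteq> {}" using that by (simp add: point_def)
      have "forces (Neg (Neg (r D))) Y c \<longleftrightarrow> k ` Y \<subseteq> D" for D by (simp add: r image_subset_iff)
      then have "forces t Y c \<longleftrightarrow> (\<exists>D\<in>?S. k ` Y \<subseteq> D)" unfolding t by simp
      also have "\<dots> \<longleftrightarrow> b \<in> f (k ` Y)"
        using fanti[OF ne] kM[of Y] ne by blast
      finally show ?thesis .
    qed
    then show ?thesis by blast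
  qed
  then obtain T where T: "\<And>b Y c. point Y c \<Longrightarrow> forces (T b) Y c \<longleftrightarrow> b \<in> f (k ` Y)" by metis
  define h where "h b = abs_free (T b)" for b
  have h: "holds (h b) Y c \<longleftrightarrow> b \<in> f (k ` Y)" if "point Y c" for b Y c
    using that by (simp add: h_def holds_abs_free T)
  have prime: "f (k ` Y) \<in> ?X" if "point Y c" for Y c
    using fX kM that by (simp add: point_def)
  have "h (a \<sqinter> b) = meet free_pdl (h a) (h b)" "h (a \<squnion> b) = join free_pdl (h a) (h b)"
    "h (\<sim> a) = neg free_pdl (h a)" if ab: "a \<in> carrier A" "b \<in> carrier A" for a b
  proof -
    show "h (a \<sqinter> b) = meet free_pdl (h a) (h b)"
      by (rule free_pdl_eqI) (simp add: h holds_free_pdl primeD(5)[OF prime ab])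
    show "h (a \<squnion> b) = join free_pdl (h a) (h b)"
      by (rule free_pdl_eqI) (simp add: h holds_free_pdl primeD(6)[OF prime ab])
    show "h (\<sim> a) = neg free_pdl (h a)"
    proof (rule free_pdl_eqI)
      fix Y :: "nat set set" and c assume p: "point Y c"
      then have "maximals (upset ?X (f (k ` Y))) = (\<lambda>q. f {q}) ` k ` Y"
        by (intro fmax kM) (simp add: point_def)
      then show "holds (h (\<sim> a)) Y c \<longleftrightarrow> holds (neg free_pdl (h a)) Y c"
        using p by (simp add: h holds_free_pdl neg_mem_iff[OF prime[OF p] ab(1)])
    qed
  qed
  moreover have "h \<zero> = zero free_pdl"
    by (rule free_pdl_eqI) (simp add: h holds_free_pdl primeD(4)[OF prime])
  moreover have "h \<one> = one free_pdl"
    by (rule free_pdl_eqI) (simp add: h holds_free_pdl primeD(3)[OF prime])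
  ultimately have "is_hom A free_pdl h" by (simp add: is_hom_def free_pdl_def)
  moreover have "inj_on h (carrier A)"
  proof (rule inj_onI)
    fix a b assume ab: "a \<in> carrier A" "b \<in> carrier A" and eq: "h a = h b"
    show "a = b"
    proof (rule prime_filters_inject[OF ab])
      fix P assume "P \<in> ?X"
      then obtain Y where Y: "Y \<noteq> {}" "Y \<subseteq> M" "f Y = P" using fonto by blast
      have kY: "k ` (k -` Y) = Y" using Y(2) k by (auto simp: image_vimage_eq)
      then have "k -` Y \<noteq> {}" using Y(1) by (metis image_empty)
      then have "point (k -` Y) {}" by (simp add: point_def)
      then show "a \<in> P \<longleftrightarrow> b \<in> P" using h[of "k -` Y" "{}"] kY Y(3) eq by metis
    qed
  qed
  ultimately show ?thesis by blast
qed


section \<open>Universal theories and finite subalgebras\<close>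

lemma valid_foldr_FAll: "valid A (foldr FAll xs P) \<longleftrightarrow> valid A P"
proof (induction xs)
  case (Cons x xs)
  have "valid A (FAll x Q) \<longleftrightarrow> valid A Q" for Q
  proof
    assume all: "valid A (FAll x Q)"
    show "valid A Q"
      unfolding valid_def
    proof (intro allI impI)
      fix v :: "nat \<Rightarrow> 'a" assume v: "range v \<subseteq> carrier A"
      then have "sat A v (FAll x Q)" using all unfolding valid_def by blast
      moreover have "v x \<in> carrier A" using v by blast
      ultimately have "sat A (v(x := v x)) Q" by (simp del: fun_upd_triv)
      then show "sat A v Q" by simp
    qed
  next
    assume Q: "valid A Q"
    show "valid A (FAll x Q)"
      unfolding valid_def
    proof (intro allI impI)
      fix v :: "nat \<Rightarrow> 'a" assume v: "range v \<subseteq> carrier A"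
      have "sat A (v(x := a)) Q" if "a \<in> carrier A" for a
      proof -
        have "range (v(x := a)) \<subseteq> carrier A" using v that by auto
        then show ?thesis using Q unfolding valid_def by blast
      qed
      then show "sat A v (FAll x Q)" by simp
    qed
  qed
  then show ?case using Cons by simp
qed simp

lemma finite_set_trm: "finite (set_trm t)"
  by (induction t) auto

lemma finite_free_vars: "finite (free_vars P)"
  by (induction P) (auto simp: finite_set_trm)

lemma free_vars_foldr_FAll: "free_vars (foldr FAll xs P) = free_vars P - set xs"
  by (induction xs) auto

lemma models_universal_theory_iff:
  "A \<in> models (universal_theory F) \<longleftrightarrow>
    algebra A \<and> (\<forall>P. quantifier_free P \<longrightarrow> valid F P \<longrightarrow> valid A P)"
proof -
  have "valid A P" if A: "\<forall>\<phi>\<in>universal_theory F. valid A \<phi>" and P: "quantifier_free P" "valid F P" for P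
  proof -
    obtain xs where xs: "set xs = free_vars P" using finite_list[OF finite_free_vars] by blast
    have "universal_sentence (foldr FAll xs P)"
      unfolding universal_sentence_def using P(1) xs free_vars_foldr_FAll[of xs P] by blast
    then have "foldr FAll xs P \<in> universal_theory F"
      using P(2) by (simp add: universal_theory_def valid_foldr_FAll)
    then show ?thesis using A valid_foldr_FAll by blast
  qed
  then show ?thesis
    unfolding models_def universal_theory_def universal_sentence_def
    using valid_foldr_FAll by (smt (verit, best) mem_Collect_eq)
qed

text \<open>The axioms of pseudocomplemented distributive lattices, including the equivalence that
  defines the pseudocomplement, are universal.\<close>

lemma model_pdl:
  fixes A :: "'a alg" and F :: "'b alg"
  assumes A: "A \<in> models (universal_theory F)" and F: "pdl F"
  shows "pdl A"
proof -
  interpret F: pdl F by (rule F)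
  interpret A: algebra A using A by (simp add: models_universal_theory_iff)
  have ax: "sat A (\<lambda>n. if n = 0 then a else if n = 1 then b else c) P"
    if "quantifier_free P" "\<And>w. range w \<subseteq> carrier F \<Longrightarrow> sat F w P"
      "a \<in> carrier A" "b \<in> carrier A" "c \<in> carrier A" for P a b c
  proof -
    have "valid A P" using A that(1,2) by (simp add: models_universal_theory_iff valid_def)
    moreover have "range (\<lambda>n::nat. if n = 0 then a else if n = 1 then b else c) \<subseteq> carrier A"
      using that by auto
    ultimately show ?thesis unfolding valid_def by blast
  qed
  have w: "w i \<in> carrier F" if "range w \<subseteq> carrier F" for w :: "nat \<Rightarrow> 'b" and i
    using that by blast
  let ?x = "Var 0 :: nat trm" and ?y = "Var 1 :: nat trm" and ?z = "Var 2 :: nat trm"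
  show ?thesis
  proof (unfold_locales)
    fix a b c assume c: "a \<in> carrier A" "b \<in> carrier A" "c \<in> carrier A"
    show "meet A (meet A a b) c = meet A a (meet A b c)"
      using ax[of "Equ (Meet (Meet ?x ?y) ?z) (Meet ?x (Meet ?y ?z))", OF _ _ c]
      by (simp add: F.meet_assoc w)
    show "join A (join A a b) c = join A a (join A b c)"
      using ax[of "Equ (Join (Join ?x ?y) ?z) (Join ?x (Join ?y ?z))", OF _ _ c]
      by (simp add: F.join_assoc w)
    show "meet A a (join A b c) = join A (meet A a b) (meet A a c)"
      using ax[of "Equ (Meet ?x (Join ?y ?z)) (Join (Meet ?x ?y) (Meet ?x ?z))", OF _ _ c]
      by (simp add: F.meet_distrib w)
  next
    fix a b assume c: "a \<in> carrier A" "b \<in> carrier A"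
    show "meet A a b = meet A b a"
      using ax[of "Equ (Meet ?x ?y) (Meet ?y ?x)", OF _ _ c c(1)] F.meet_comm w by simp
    show "join A a b = join A b a"
      using ax[of "Equ (Join ?x ?y) (Join ?y ?x)", OF _ _ c c(1)] F.join_comm w by simp
    show "meet A a (join A a b) = a"
      using ax[of "Equ (Meet ?x (Join ?x ?y)) ?x", OF _ _ c c(1)] by (simp add: F.meet_absorb w)
    show "join A a (meet A a b) = a"
      using ax[of "Equ (Join ?x (Meet ?x ?y)) ?x", OF _ _ c c(1)] by (simp add: F.join_absorb w)
    show "le A a (neg A b) \<longleftrightarrow> meet A a b = zero A"
      using ax[of "FAnd (FImp (Equ (Meet ?x (Neg ?y)) ?x) (Equ (Meet ?x ?y) Zero))
          (FImp (Equ (Meet ?x ?y) Zero) (Equ (Meet ?x (Neg ?y)) ?x))", OF _ _ c c(1)]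
        F.pseudocomplement w unfolding le_def by auto
  next
    fix a assume c: "a \<in> carrier A"
    show "le A (zero A) a"
      using ax[of "Equ (Meet Zero ?x) Zero", OF _ _ c c c] F.zero_least w unfolding le_def by simp
    show "le A a (one A)"
      using ax[of "Equ (Meet ?x One) ?x", OF _ _ c c c] F.one_greatest w unfolding le_def by simp
  qed
qed

text \<open>The conjunction of the formulas of \<open>L\<close> or their negations, as they are true or false under \<open>v\<close>,
  is satisfiable in \<open>A\<close>. Its negation is therefore not a consequence of the universal theory of \<open>F\<close>.\<close>

lemma model_realizes_finite_type:
  fixes A :: "'a alg" and F :: "'b alg"
  assumes A: "A \<in> models (universal_theory F)" and v: "range v \<subseteq> carrier A"
    and L: "finite L" "\<And>\<chi>. \<chi> \<in> L \<Longrightarrow> quantifier_free \<chi>"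
  obtains w where "range w \<subseteq> carrier F" "\<And>\<chi>. \<chi> \<in> L \<Longrightarrow> sat F w \<chi> \<longleftrightarrow> sat A v \<chi>"
proof -
  have "\<exists>\<theta>. quantifier_free \<theta> \<and> sat A v \<theta> \<and>
      (\<forall>w. sat F w \<theta> \<longrightarrow> (\<forall>\<chi>\<in>L. sat F w \<chi> \<longleftrightarrow> sat A v \<chi>))"
    using L
  proof (induction L)
    case empty
    show ?case by (rule exI[of _ "Equ Zero Zero"]) simp
  next
    case (insert \<chi> L)
    then obtain \<theta> where "quantifier_free \<theta>" "sat A v \<theta>"
      "\<And>w. sat F w \<theta> \<Longrightarrow> \<forall>\<chi>\<in>L. sat F w \<chi> \<longleftrightarrow> sat A v \<chi>" by blast
    then show ?case
      using insert.prems
      by (intro exI[of _ "FAnd (if sat A v \<chi> then \<chi> else FNot \<chi>) \<theta>"]) auto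
  qed
  then obtain \<theta> where \<theta>: "quantifier_free \<theta>" "sat A v \<theta>"
    "\<And>w. sat F w \<theta> \<Longrightarrow> \<forall>\<chi>\<in>L. sat F w \<chi> \<longleftrightarrow> sat A v \<chi>" by blast
  have "\<not> valid A (FNot \<theta>)" using v \<theta>(2) unfolding valid_def by auto
  then have "\<not> valid F (FNot \<theta>)" using A \<theta>(1) by (auto simp: models_universal_theory_iff)
  then show thesis using \<theta>(3) that unfolding valid_def by auto
qed

text \<open>Realize the finite diagram of \<open>B\<close> in \<open>F\<close>.\<close>

lemma finite_subalgebra_embeds:
  fixes A :: "'a alg" and F :: "'b alg"
  assumes A: "A \<in> models (universal_theory F)"
    and B: "B \<in> subalgebras A" and fin: "finite (carrier B)"
  shows "\<exists>h. is_hom B F h \<and> inj_on h (carrier B)"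
proof -
  obtain S where S: "S \<subseteq> carrier A" "B = A\<lparr>carrier := S\<rparr>" and "algebra B"
    using B by (auto simp: subalgebras_def)
  interpret B: algebra B by fact
  have cl: "meet A a b \<in> S" "join A a b \<in> S" "neg A a \<in> S" "zero A \<in> S" "one A \<in> S"
    if "a \<in> S" "b \<in> S" for a b
    using that B.meet_closed B.join_closed B.neg_closed B.zero_closed B.one_closed S(2) by simp_all
  have z: "zero A \<in> S" "one A \<in> S" using B.zero_closed B.one_closed S(2) by simp_all
  have finS: "finite S" using fin S(2) by simp
  then obtain i :: "'a \<Rightarrow> nat" where i: "inj_on i S"
    using finite_imp_inj_to_nat_seg by blast
  define v where "v n = (if n \<in> i ` S then inv_into S i n else zero A)" for n
  have vi: "v (i a) = a" if "a \<in> S" for a using that i by (simp add: v_def)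
  have v: "range v \<subseteq> carrier A"
    using S(1) z(1) inv_into_into[of _ i S] unfolding v_def by auto
  let ?V = "\<lambda>a. Var (i a)"
  define L where "L = (\<Union>a\<in>S. \<Union>b\<in>S. {Equ (?V a) (?V b),
    Equ (?V (meet A a b)) (Meet (?V a) (?V b)), Equ (?V (join A a b)) (Join (?V a) (?V b)),
    Equ (?V (neg A a)) (Neg (?V a)), Equ (?V (zero A)) Zero, Equ (?V (one A)) One})"
  have "finite L" using finS by (simp add: L_def)
  moreover have "quantifier_free \<chi>" if "\<chi> \<in> L" for \<chi> using that by (auto simp: L_def)
  ultimately obtain w where w: "range w \<subseteq> carrier F"
    "\<And>\<chi>. \<chi> \<in> L \<Longrightarrow> sat F w \<chi> \<longleftrightarrow> sat A v \<chi>"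
    using model_realizes_finite_type[OF A v] by blast
  define h where "h a = w (i a)" for a
  have inL: "Equ (?V a) (?V b) \<in> L"
    "Equ (?V (meet A a b)) (Meet (?V a) (?V b)) \<in> L"
    "Equ (?V (join A a b)) (Join (?V a) (?V b)) \<in> L"
    "Equ (?V (neg A a)) (Neg (?V a)) \<in> L"
    "Equ (?V (zero A)) Zero \<in> L" "Equ (?V (one A)) One \<in> L" if "a \<in> S" "b \<in> S" for a b
    using that unfolding L_def by blast+
  have "h (meet A a b) = meet F (h a) (h b)" "h (join A a b) = join F (h a) (h b)"
    "h (neg A a) = neg F (h a)" if "a \<in> S" "b \<in> S" for a b
    using w(2)[OF inL(2)[OF that]] w(2)[OF inL(3)[OF that]] w(2)[OF inL(4)[OF that]] that
    by (simp_all add: h_def vi cl)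
  moreover have "h (zero A) = zero F" "h (one A) = one F"
    using w(2)[OF inL(5)[OF z]] w(2)[OF inL(6)[OF z]] z by (simp_all add: h_def vi)
  moreover have "inj_on h S"
  proof (rule inj_onI)
    fix a b assume ab: "a \<in> S" "b \<in> S" "h a = h b"
    then show "a = b" using w(2)[OF inL(1)[OF ab(1,2)]] by (simp add: h_def vi)
  qed
  ultimately have "is_hom B F h \<and> inj_on h (carrier B)"
    using w(1) unfolding is_hom_def S(2) by (auto simp: h_def)
  then show ?thesis by blast
qed

lemma (in pdl) subalgebra_pdl: "B \<in> subalgebras A \<Longrightarrow> pdl B"
  unfolding subalgebras_def pdl_def pdl_axioms_def le_def
  using meet_assoc join_assoc meet_comm join_comm meet_absorb join_absorb meet_distrib
    zero_least one_greatest pseudocomplement unfolding le_def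
  by (auto simp: subset_iff)

lemma (in algebra) generated_subalgebra:
  assumes v: "range v \<subseteq> carrier A"
  shows "A\<lparr>carrier := {eval A v t |t. set_trm t \<subseteq> V}\<rparr> \<in> subalgebras A"
proof -
  define S where "S = {eval A v t |t. set_trm t \<subseteq> V}"
  have op: "eval A v t \<in> S" if "set_trm t \<subseteq> V" for t using that by (auto simp: S_def)
  have "meet A a b \<in> S" "join A a b \<in> S" "neg A a \<in> S" if ab: "a \<in> S" "b \<in> S" for a b
  proof -
    obtain s t where "a = eval A v s" "b = eval A v t" "set_trm s \<subseteq> V" "set_trm t \<subseteq> V"
      using ab by (auto simp: S_def)
    then show "meet A a b \<in> S" "join A a b \<in> S" "neg A a \<in> S"
      using op[of "Meet s t"] op[of "Join s t"] op[of "Neg s"] by simp_all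
  qed
  moreover have "zero A \<in> S" "one A \<in> S" using op[of Zero] op[of One] by simp_all
  ultimately have "algebra (A\<lparr>carrier := S\<rparr>)" by (simp add: algebra_def)
  moreover have "S \<subseteq> carrier A" using eval_closed[OF v] by (auto simp: S_def)
  ultimately show ?thesis unfolding subalgebras_def S_def by blast
qed

lemma eval_hom:
  assumes "is_hom B F h" "algebra B"
    and "\<And>x. x \<in> set_trm t \<Longrightarrow> v x \<in> carrier B" "\<And>x. x \<in> set_trm t \<Longrightarrow> w x = h (v x)"
  shows "eval F w t = h (eval B v t) \<and> eval B v t \<in> carrier B"
proof -
  interpret B: algebra B by fact
  show ?thesis
    using assms(3,4)
    by (induction t) (use assms(1) B.meet_closed B.join_closed B.neg_closed B.zero_closed
      B.one_closed in \<open>auto simp: is_hom_def\<close>)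
qed

lemma sat_embedding:
  assumes "is_hom B F h" "inj_on h (carrier B)" "algebra B" "quantifier_free P"
    and "\<And>x. x \<in> free_vars P \<Longrightarrow> v x \<in> carrier B" "\<And>x. x \<in> free_vars P \<Longrightarrow> w x = h (v x)"
  shows "sat F w P \<longleftrightarrow> sat B v P"
  using assms(4-6)
proof (induction P)
  case (Equ s t)
  then show ?case
    using eval_hom[OF assms(1,3), of s v w] eval_hom[OF assms(1,3), of t v w] assms(2)
    by (auto dest: inj_onD)
qed auto

lemma eval_carrier_update: "eval (A\<lparr>carrier := S\<rparr>) v t = eval A v t"
  by (induction t) simp_all

lemma sat_carrier_update: "quantifier_free P \<Longrightarrow> sat (A\<lparr>carrier := S\<rparr>) v P \<longleftrightarrow> sat A v P"
  by (induction P) (simp_all add: eval_carrier_update)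

section \<open>The models of the universal theory of the free algebra\<close>

theorem theorem6p1:
  shows "(models (universal_theory (free_pdl :: nat free alg)) :: 'a alg set) =
    {A. pdl A \<and>
        (\<forall>B\<in>subalgebras A. finite (carrier B) \<longrightarrow> has_free_skeleton (prime_filters B))}"
proof (intro set_eqI iffI)
  fix A :: "'a alg"
  assume A: "A \<in> models (universal_theory (free_pdl :: nat free alg))"
  then interpret pdl A by (rule model_pdl[OF _ pdl_free_pdl])
  have "has_free_skeleton (prime_filters B)" if B: "B \<in> subalgebras A" "finite (carrier B)" for B
    using finite_subalgebra_embeds[OF A B] pdl.embedding_imp_free_skeleton[OF subalgebra_pdl[OF B(1)] B(2)]
    by blast
  then show "A \<in> {A. pdl A \<and>
      (\<forall>B\<in>subalgebras A. finite (carrier B) \<longrightarrow> has_free_skeleton (prime_filters B))}"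
    using pdl_axioms by blast
next
  fix A :: "'a alg"
  assume "A \<in> {A. pdl A \<and>
      (\<forall>B\<in>subalgebras A. finite (carrier B) \<longrightarrow> has_free_skeleton (prime_filters B))}"
  then have "pdl A" and skel: "\<And>B. B \<in> subalgebras A \<Longrightarrow> finite (carrier B) \<Longrightarrow>
      has_free_skeleton (prime_filters B)" by auto
  then interpret pdl A by blast
  have "sat A v P" if P: "quantifier_free P" "valid (free_pdl :: nat free alg) P"
    and v: "range v \<subseteq> carrier A" for P v
  proof -
    \<comment> \<open>The values of the variables of \<open>P\<close> generate a finite subalgebra, and \<open>P\<close> can be evaluated
      there and, through the embedding, in the free algebra.\<close>
    define B where "B = A\<lparr>carrier := {eval A v t |t. set_trm t \<subseteq> free_vars P}\<rparr>"
    have B: "B \<in> subalgebras A" unfolding B_def by (rule generated_subalgebra[OF v])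
    have fin: "finite (carrier B)"
      using generated_finite[OF v finite_free_vars] by (simp add: B_def)
    interpret B: pdl B by (rule subalgebra_pdl[OF B])
    obtain h :: "'a \<Rightarrow> nat free" where h: "is_hom B free_pdl h" "inj_on h (carrier B)"
      using B.free_skeleton_imp_embedding[OF fin skel[OF B fin]] by blast
    have "v x \<in> carrier B" if "x \<in> free_vars P" for x
      using that by (auto simp: B_def intro: exI[of _ "Var x"])
    then have "sat free_pdl (\<lambda>x. h (v x)) P \<longleftrightarrow> sat B v P"
      by (intro sat_embedding[OF h B.algebra_axioms P(1)]) simp_all
    moreover have "sat free_pdl (\<lambda>x. h (v x)) P"
      using P(2) by (simp add: valid_def free_pdl_def)
    ultimately show ?thesis by (simp add: B_def sat_carrier_update[OF P(1)])
  qed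
  then show "A \<in> models (universal_theory (free_pdl :: nat free alg))"
    by (simp add: models_universal_theory_iff valid_def algebra_axioms)
qed

end
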